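(* Fix an integer $n\ge1$. Let $1\le p<q<\infty$ and $\theta=p/q$. Then there exists a positive constant $C$, depending on $p$ and $q$ (the dimension $n$ being fixed), such that for every $g$ with $\frac{\partial g}{\partial r}\in L^p(\mathbb{R}\times\mathbb{S}^{n-1})$ and $g\in B^{\theta/(\theta-1)}$, $$\|G\|_{L^q(\mathbb{R})}\le C\,\Big\|\frac{\partial g}{\partial r}\Big\|^{\theta}_{L^p(\mathbb{R}\times\mathbb{S}^{n-1})}\,\|g\|_{B^{\theta/(\theta-1)}}^{1-\theta},$$ where $G$ is the integral mean of $g$ over $\mathbb{S}^{n-1}$.
   Context: $\mathbb{R}\times\mathbb{S}^{n-1}$ carries the product of Lebesgue measure on $\mathbb{R}$ and the usual surface measure on the unit sphere $\mathbb{S}^{n-1}\subset\mathbb{R}^n$; points are written $(r,\omega)$ and $\partial/\partial r$ is the (distributional) derivative in the $\mathbb{R}$ variable. The integral mean of $g$ over the sphere is $$G(r)=\mathcal{M}(g)(r)=\frac1{|\mathbb{S}^{n-1}|}\int_{\mathbb{S}^{n-1}}g(r,\omega)\,d\omega$$ (for a distribution $g$, this is the corresponding distribution on $\mathbb{R}$, obtained by testing $g$ against functions independent of $\omega$; if $\partial g/\partial r\in L^p$, then $G$ has an $L^p$ distributional derivative, hence is a continuous function). For $t>0$ and a function $H$ on $\mathbb{R}$ put $$T_tH(r)=\frac1{\sqrt{4\pi t}}\int_{\mathbb{R}}e^{-(r-s)^2/(4t)}H(s)\,ds .$$ (In the paper $T_t$ arises as $\Phi e^{-tA^2}\Phi^{-1}$,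 where $(\Phi\psi)(s,\omega)=e^{sn/2}\psi(e^s\omega)$ and $A=-i(\mathbf{x}\cdot\nabla+\frac n2)$ is the generator of dilations in $L^2(\mathbb{R}^n)$; moreover $\Phi A\Phi^{-1}g=-i\,\partial g/\partial r$.) For real $\alpha$, $B^\alpha$ is the space of all tempered distributions $g$ on $\mathbb{R}\times\mathbb{S}^{n-1}$ (with mean $G$ a function) for which $$\|g\|_{B^\alpha}:=\sup_{t>0}\big\{t^{-\alpha/2}\,\|T_t|G|\|_{L^\infty(\mathbb{R})}\big\}<\infty .$$ Note that $\theta/(\theta-1)<0$. *)

theory Defs
  imports "HOL-Probability.Essential_Supremum"
begin

section \<open>Smooth functions\<close>

fun pderivs :: "'a::euclidean_space list \<Rightarrow> ('a \<Rightarrow> 'b::real_normed_vector) \<Rightarrow> 'a \<Rightarrow> 'b" where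
  "pderivs [] f = f"
| "pderivs (v # vs) f = (\<lambda>x. frechet_derivative (pderivs vs f) (at x) v)"

text \<open>For open \<open>S\<close> this is membership in \<open>C\<^sup>\<infinity>(S)\<close>: every iterated partial derivative is
  differentiable, hence continuous, at every point of \<open>S\<close>.\<close>

definition smooth_on :: "'a::euclidean_space set \<Rightarrow> ('a \<Rightarrow> 'b::real_normed_vector) \<Rightarrow> bool" where
  "smooth_on S f \<longleftrightarrow>
     (\<forall>vs. set vs \<subseteq> Basis \<longrightarrow> (\<forall>x\<in>S. pderivs vs f differentiable (at x)))"

definition test_functions :: "(real \<Rightarrow> complex) set" where
  "test_functions = {\<psi>. smooth_on UNIV \<psi> \<and> (\<exists>R. \<forall>r. \<bar>r\<bar> > R \<longrightarrow> \<psi> r = 0)}"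


section \<open>The cylinder over the unit sphere\<close>

text \<open>Surface measure on the unit sphere of \<open>\<real>\<^sup>n\<close>, via polar coordinates: a Borel set \<open>A\<close> of
  the sphere has surface measure \<open>n\<close> times the volume of the cone \<open>{s \<omega> | 0 < s \<le> 1, \<omega> \<in> A}\<close>.
  For \<open>n = 1\<close> it is the counting measure on \<open>{-1, 1}\<close>.  Recall that \<open>sgn x = x /\<^sub>R norm x\<close>.\<close>

definition sphere_measure :: "(real ^ 'n) measure" where
  "sphere_measure =
     scale_measure (of_nat CARD('n))
       (distr (restrict_space lborel (cball 0 1 - {0})) (restrict_space borel (sphere 0 1)) sgn)"

definition cyl_measure :: "(real \<times> (real ^ 'n)) measure" where
  "cyl_measure = lborel \<Otimes>\<^sub>M sphere_measure"

text \<open>A function on the cylinder \<open>\<real> \<times> S\<^sup>n\<^sup>-\<^sup>1\<close> is represented by a function on \<open>\<real> \<times> \<real>\<^sup>n\<close> of which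
  only the values on the cylinder matter.  Derivatives along the sphere are taken of its extension
  that is homogeneous of degree 0 in the second variable; on the compact sphere these
  derivatives generate the usual topology of smooth functions.\<close>

definition radial_ext :: "(real \<times> (real ^ 'n) \<Rightarrow> complex) \<Rightarrow> real \<times> (real ^ 'n) \<Rightarrow> complex" where
  "radial_ext \<phi> = (\<lambda>z. \<phi> (fst z, sgn (snd z)))"

definition schwartz_weight ::
  "nat \<Rightarrow> (real \<times> (real ^ 'n)) list \<Rightarrow> (real \<times> (real ^ 'n) \<Rightarrow> complex) \<Rightarrow> real \<times> (real ^ 'n) \<Rightarrow> real"
  where "schwartz_weight k vs \<phi> z = \<bar>fst z\<bar> ^ k * norm (pderivs vs (radial_ext \<phi>) z)"

definition schwartz_seminorm ::
  "nat \<Rightarrow> (real \<times> (real ^ 'n)) list \<Rightarrow> (real \<times> (real ^ 'n) \<Rightarrow> complex) \<Rightarrow> real"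
  where "schwartz_seminorm k vs \<phi> = (SUP z\<in>UNIV \<times> sphere 0 1. schwartz_weight k vs \<phi> z)"

text \<open>The Schwartz space of the cylinder.  Its elements are normalised to vanish off the cylinder, so
  that two of them are equal as soon as they agree on the cylinder.\<close>

definition schwartz :: "(real \<times> (real ^ 'n) \<Rightarrow> complex) set" where
  "schwartz = {\<phi>. (\<forall>r x. norm x \<noteq> 1 \<longrightarrow> \<phi> (r, x) = 0) \<and>
      smooth_on (UNIV \<times> (- {0})) (radial_ext \<phi>) \<and>
      (\<forall>k vs. set vs \<subseteq> Basis \<longrightarrow>
         bdd_above (schwartz_weight k vs \<phi> ` (UNIV \<times> sphere 0 1)))}"


section \<open>Tempered distributions on the cylinder\<close>

type_synonym 'n cyl_functional = "(real \<times> (real ^ 'n) \<Rightarrow> complex) \<Rightarrow> complex"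

definition tempered_distribution :: "('n::finite) cyl_functional \<Rightarrow> bool" where
  "tempered_distribution g \<longleftrightarrow>
     (\<forall>\<phi>\<in>schwartz. \<forall>\<psi>\<in>schwartz. g (\<lambda>z. \<phi> z + \<psi> z) = g \<phi> + g \<psi>) \<and>
     (\<forall>c. \<forall>\<phi>\<in>schwartz. g (\<lambda>z. c * \<phi> z) = c * g \<phi>) \<and>
     (\<exists>N C. \<forall>\<phi>\<in>schwartz. norm (g \<phi>) \<le>
        C * (\<Sum>k\<le>N. \<Sum>vs\<in>{vs. set vs \<subseteq> Basis \<and> length vs \<le> N}. schwartz_seminorm k vs \<phi>))"

definition partial_r ::
  "(real \<times> (real ^ 'n) \<Rightarrow> complex) \<Rightarrow> real \<times> (real ^ 'n) \<Rightarrow> complex" where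
  "partial_r \<phi> = (\<lambda>(r, x). vector_derivative (\<lambda>s. \<phi> (s, x)) (at r))"

definition dist_partial_r :: "('n::finite) cyl_functional \<Rightarrow> 'n cyl_functional" where
  "dist_partial_r g = (\<lambda>\<phi>. - g (partial_r \<phi>))"

text \<open>The distribution is given by a locally integrable function \<open>h\<close>.  Testing on functions of
  compact support, which are dense in the Schwartz space, keeps the integral meaningful
  for every such \<open>h\<close>.\<close>

definition dist_is_function ::
  "('n::finite) cyl_functional \<Rightarrow> (real \<times> (real ^ 'n) \<Rightarrow> complex) \<Rightarrow> bool" where
  "dist_is_function u h \<longleftrightarrow>
     (\<forall>R. set_integrable cyl_measure ({- R..R} \<times> sphere 0 1) h) \<and>
     (\<forall>\<phi>\<in>schwartz. (\<exists>R. \<forall>r x. \<bar>r\<bar> > R \<longrightarrow> \<phi> (r, x) = 0) \<longrightarrow>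
        u \<phi> = (\<integral>z. h z * \<phi> z \<partial>cyl_measure))"

text \<open>The mean of a distribution over the sphere, tested against functions of \<open>r\<close> alone.\<close>

definition const_ext :: "(real \<Rightarrow> complex) \<Rightarrow> real \<times> (real ^ 'n) \<Rightarrow> complex" where
  "const_ext \<psi> = (\<lambda>(r, x). if norm x = 1 then \<psi> r else 0)"

definition dist_mean :: "('n::finite) cyl_functional \<Rightarrow> (real \<Rightarrow> complex) \<Rightarrow> complex" where
  "dist_mean g \<psi> =
     g (const_ext \<psi>) / of_real (measure (sphere_measure :: (real ^ 'n) measure) (sphere 0 1))"

definition is_mean_function :: "('n::finite) cyl_functional \<Rightarrow> (real \<Rightarrow> complex) \<Rightarrow> bool" where
  "is_mean_function g G \<longleftrightarrow>
     (\<forall>R. set_integrable lborel {- R..R} G) \<and>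
     (\<forall>\<psi>\<in>test_functions. dist_mean g \<psi> = (\<integral>r. G r * \<psi> r \<partial>lborel))"

text \<open>A representative of the mean, when the latter is a function; it is unique up to null sets.\<close>

definition mean_function :: "('n::finite) cyl_functional \<Rightarrow> real \<Rightarrow> complex" where
  "mean_function g = (SOME G. is_mean_function g G)"


section \<open>Function spaces\<close>

definition in_Lp :: "real \<Rightarrow> 'a measure \<Rightarrow> ('a \<Rightarrow> complex) \<Rightarrow> bool" where
  "in_Lp p M f \<longleftrightarrow> f \<in> borel_measurable M \<and> integrable M (\<lambda>x. norm (f x) powr p)"

definition Lp_norm :: "real \<Rightarrow> 'a measure \<Rightarrow> ('a \<Rightarrow> complex) \<Rightarrow> real" where
  "Lp_norm p M f = (\<integral>x. norm (f x) powr p \<partial>M) powr (1 / p)"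

text \<open>The operator \<open>T\<^sub>t\<close> is only ever applied to nonnegative functions, for which it is defined
  with values in \<open>[0, \<infinity>]\<close>.\<close>

definition heat :: "real \<Rightarrow> (real \<Rightarrow> ennreal) \<Rightarrow> real \<Rightarrow> ennreal" where
  "heat t H r = ennreal (1 / sqrt (4 * pi * t)) *
     (\<integral>\<^sup>+ s. ennreal (exp (- (r - s)\<^sup>2 / (4 * t))) * H s \<partial>lborel)"

definition B_norm :: "real \<Rightarrow> ('n::finite) cyl_functional \<Rightarrow> ennreal" where
  "B_norm \<alpha> g = (SUP t\<in>{0<..}. ennreal (t powr (- \<alpha> / 2)) *
     esssup lborel (heat t (\<lambda>s. ennreal (norm (mean_function g s)))))"

definition B_space :: "real \<Rightarrow> ('n::finite) cyl_functional set" where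
  "B_space \<alpha> = {g. tempered_distribution g \<and> (\<exists>G. is_mean_function g G) \<and> B_norm \<alpha> g < \<infinity>}"

end

theory Submission
  imports Defs
begin

text \<open>
The proof rests on two facts: the mean \<open>G\<close> is, up to a null set, an absolutely continuous function \<open>F\<close> whose derivative
is the spherical mean \<open>H\<close> of \<open>h\<close>, and the Besov norm measures \<open>norm G\<close> rather than \<open>G\<close>. By Jensen's inequality the \<open>L\<^sup>p\<close> norm of
\<open>H\<close> on the line is controlled by that of \<open>h\<close> on the cylinder (\<open>sphere_mean_Lp\<close>), so that everything takes place on the line.

Since the heat kernel is positive and is applied to \<open>norm G\<close>, its value at time \<open>h\<^sup>2\<close> dominates, up to a constant,
averages over intervals of length \<open>h\<close>. Hence each interval of length \<open>h\<close> contains a low point, where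
\<open>norm (F s) \<le> M * h powr (- \<beta>)\<close>; here \<open>\<beta> = p / (q - p)\<close>, since \<open>\<theta> / (\<theta> - 1) = - \<beta>\<close>, and \<open>M\<close> is proportional to the
Besov norm (\<open>low_point_of_B_norm\<close>).

Now fix a level \<open>l\<close> and choose \<open>h\<close> with \<open>M * h powr (- \<beta>) = l\<close>. If \<open>norm F\<close> reaches \<open>2 * l\<close> in a cell of length \<open>h\<close>, it must
cross the band between \<open>l\<close> and \<open>2 * l\<close> on its way to a low point of the cell. So the integral of \<open>norm H\<close> over the part of the
cell where \<open>F\<close> is in the band is at least \<open>l\<close>, and Jensen's inequality bounds \<open>l powr p\<close> by \<open>h powr (p - 1)\<close> times
the integral of \<open>norm H powr p\<close> there. Adding up the cells gives a bound for the measure of \<open>{s. 2 * l \<le> norm (F s)}\<close> by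
\<open>M powr (q - p) * l powr (- q)\<close> times the integral of \<open>norm H powr p\<close> over the band (\<open>superlevel_measure_le\<close>). For
dyadic levels the bands are disjoint, and summing \<open>l powr q\<close> times these bounds gives the \<open>q\<close>-th power of the inequality
(\<open>nn_integral_powr_le_of_low_points\<close>). Because of the localisation to bands the argument is uniform in \<open>p \<ge> 1\<close>; a pointwise
bound by the maximal function of \<open>H\<close> would give only a weak-type estimate for \<open>p = 1\<close>.

That \<open>G\<close> has the derivative \<open>H\<close> is the lemma of du Bois-Reymond (\<open>weak_derivative_imp_primitive\<close>), applied to the
equation for the radial derivative of \<open>g\<close>, tested with functions of \<open>r\<close> alone (\<open>mean_function_primitive\<close>). It needs enough test functions, which are
built from \<open>exp (- 1 / x)\<close>, and the fact that a test function of \<open>r\<close> is a Schwartz function on the cylinder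
(\<open>const_ext_in_schwartz\<close>).
\<close>

section \<open>Power means and level crossings\<close>

text \<open>Jensen's inequality for \<open>x powr p\<close>, including the value \<open>x = 0\<close>: the function lies above its tangent at the
mean value \<open>a\<close> (by Young's inequality), and the linear term of the tangent integrates to zero.\<close>

lemma (in finite_measure) integral_powr_le:
  fixes f :: "'a \<Rightarrow> real"
  assumes p: "1 \<le> p" and f: "integrable M f" and fp: "integrable M (\<lambda>x. f x powr p)"
    and nonneg: "\<And>x. 0 \<le> f x"
  shows "(\<integral>x. f x \<partial>M) powr p \<le> measure M (space M) powr (p - 1) * (\<integral>x. f x powr p \<partial>M)"
proof -
  define m where "m = measure M (space M)"
  define I where "I = (\<integral>x. f x \<partial>M)"
  have I0: "0 \<le> I" unfolding I_def using nonneg by simp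
  have m0: "0 \<le> m" unfolding m_def by simp
  have J0: "0 \<le> (\<integral>x. f x powr p \<partial>M)" by simp
  show ?thesis
  proof (cases "I = 0")
    case True
    then show ?thesis using J0 m0 unfolding I_def m_def by simp
  next
    case False
    then have Ipos: "0 < I" using I0 by simp
    have "m \<noteq> 0"
    proof
      assume "m = 0"
      then have "emeasure M (space M) = 0" by (simp add: m_def emeasure_eq_measure)
      then have "AE x in M. f x = 0" by (simp add: emeasure_0_AE)
      then have "I = 0" unfolding I_def using f by (simp add: integral_eq_zero_AE)
      with Ipos show False by simp
    qed
    then have mpos: "0 < m" using m0 by simp
    define a where "a = I / m"
    have apos: "0 < a" using Ipos mpos by (simp add: a_def)
    have tangent: "a powr p + p * a powr (p - 1) * (x - a) \<le> x powr p" if "0 \<le> x" for x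
    proof (cases "x = 0")
      case True
      have "a powr (p - 1) * a = a powr p" using apos by (simp add: powr_mult_base' powr_diff)
      then have "a powr p + p * a powr (p - 1) * (x - a) = (1 - p) * a powr p"
        using True by (simp add: algebra_simps)
      then show ?thesis using p True by (simp add: mult_nonpos_nonneg)
    next
      case False
      then have x: "0 < x" using that by simp
      have "(x powr p) powr (1/p) * (a powr p) powr (1 - 1/p) \<le> (1/p) * x powr p + (1 - 1/p) * a powr p"
        by (rule Youngs_inequality_0) (use p x apos in auto)
      moreover have "(x powr p) powr (1/p) = x" using x p by (simp add: powr_powr)
      moreover have "(a powr p) powr (1 - 1/p) = a powr (p - 1)"
        using p by (simp add: powr_powr algebra_simps)
      ultimately have "p * (x * a powr (p - 1)) \<le> p * ((1/p) * x powr p + (1 - 1/p) * a powr p)"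
        using p by (intro mult_left_mono) auto
      also have "\<dots> = x powr p + (p - 1) * a powr p" using p by (simp add: field_simps)
      finally have "p * (x * a powr (p - 1)) \<le> x powr p + (p - 1) * a powr p" .
      moreover have "a powr (p - 1) * a = a powr p" using apos by (simp add: powr_mult_base' powr_diff)
      ultimately show ?thesis by (simp add: algebra_simps)
    qed
    have "(\<integral>x. a powr p + p * a powr (p - 1) * (f x - a) \<partial>M) \<le> (\<integral>x. f x powr p \<partial>M)"
      by (intro integral_mono) (use f fp tangent nonneg in auto)
    moreover have "(\<integral>x. a powr p + p * a powr (p - 1) * (f x - a) \<partial>M)
        = m * a powr p + p * a powr (p - 1) * (I - m * a)"
      using f by (simp add: I_def m_def Bochner_Integration.integral_add Bochner_Integration.integral_diff)
    moreover have "I - m * a = 0" using mpos by (simp add: a_def)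
    ultimately have "m * a powr p \<le> (\<integral>x. f x powr p \<partial>M)" by simp
    then have "m powr (p - 1) * (m * a powr p) \<le> m powr (p - 1) * (\<integral>x. f x powr p \<partial>M)"
      by (intro mult_left_mono) auto
    moreover have "m powr (p - 1) * (m * a powr p) = I powr p"
    proof -
      have "m powr (p - 1) * m = m powr p" using mpos by (simp add: powr_diff)
      moreover have "m powr p * a powr p = I powr p"
        using mpos apos by (simp add: a_def flip: powr_mult)
      ultimately show ?thesis by (metis mult.assoc)
    qed
    ultimately show ?thesis by (simp add: I_def m_def)
  qed
qed

text \<open>A continuous function descending from above \<open>M\<close> to below \<open>m\<close> traverses the band between them: start at the
last point \<open>c\<close> where it is at least \<open>M\<close>, and stop at the first later point \<open>d\<close> where it is at most \<open>m\<close>.\<close>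

lemma crossing_interval:
  fixes u :: "real \<Rightarrow> real"
  assumes ab: "a \<le> b" and u: "continuous_on {a..b} u" and hi: "M \<le> u a" and lo: "u b \<le> m" and mM: "m < M"
  obtains c d where "a \<le> c" "c \<le> d" "d \<le> b" "u c = M" "u d = m" "\<And>x. c < x \<Longrightarrow> x < d \<Longrightarrow> m < u x \<and> u x < M"
proof -
  define A where "A = {x\<in>{a..b}. M \<le> u x}"
  have "closed A" unfolding A_def
    by (intro continuous_on_closed_Collect_le) (auto intro!: continuous_intros u)
  moreover have "a \<in> A" using ab hi by (simp add: A_def)
  moreover have bA: "bdd_above A" unfolding A_def by (intro bdd_aboveI[of _ b]) auto
  ultimately have cA: "Sup A \<in> A" using closed_contains_Sup[of A] by auto
  define c where "c = Sup A"
  have c: "a \<le> c" "c \<le> b" "M \<le> u c" using cA unfolding c_def A_def by auto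
  have above: "u x < M" if "c < x" "x \<le> b" for x
  proof (rule ccontr)
    assume "\<not> u x < M"
    then have "x \<in> A" using that c by (auto simp: A_def)
    then have "x \<le> c" unfolding c_def using bA by (rule cSup_upper)
    with that show False by simp
  qed
  have uc: "continuous_on {c..b} u" using u c by (auto intro: continuous_on_subset)
  obtain x where x: "c \<le> x" "x \<le> b" "u x = M"
    using IVT2'[of u b M c] c lo mM uc by auto
  have "x = c" using above[of x] x by (cases "c < x") auto
  then have ucM: "u c = M" using x by simp
  define B where "B = {x\<in>{c..b}. u x \<le> m}"
  have "closed B" unfolding B_def
    by (intro continuous_on_closed_Collect_le) (auto intro!: continuous_intros uc)
  moreover have "b \<in> B" using c lo by (simp add: B_def)
  moreover have bB: "bdd_below B" unfolding B_def by (intro bdd_belowI[of _ c]) auto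
  ultimately have dB: "Inf B \<in> B" using closed_contains_Inf[of B] by auto
  define d where "d = Inf B"
  have d: "c \<le> d" "d \<le> b" "u d \<le> m" using dB unfolding d_def B_def by auto
  have below: "m < u x" if "c \<le> x" "x < d" for x
  proof (rule ccontr)
    assume "\<not> m < u x"
    then have "x \<in> B" using that d by (auto simp: B_def)
    then have "d \<le> x" unfolding d_def using bB by (rule cInf_lower)
    with that show False by simp
  qed
  obtain y where y: "c \<le> y" "y \<le> d" "u y = m"
    using IVT2'[of u d m c] c d ucM mM continuous_on_subset[OF uc, of "{c..d}"] by auto
  have "y = d" using below[of y] y by (cases "y < d") auto
  then show ?thesis using that[of c d] c d ucM y above below by auto
qed

text \<open>Absolute continuity of \<open>F\<close> on bounded intervals with derivative \<open>H\<close>, in the integral form of the fundamental theorem.\<close>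

definition primitive_of :: "(real \<Rightarrow> complex) \<Rightarrow> (real \<Rightarrow> complex) \<Rightarrow> bool" where
  "primitive_of F H \<longleftrightarrow> (\<forall>a b. set_integrable lborel {a..b} H) \<and>
     (\<forall>a b. a \<le> b \<longrightarrow> F b - F a = (LINT s:{a..b}|lborel. H s))"

lemma primitive_of_continuous:
  assumes "primitive_of F H"
  shows "continuous_on S F"
proof -
  have "continuous_on {a<..<b} F" for a b
  proof (cases "a \<le> b")
    case True
    have H: "set_integrable lborel {a..x} H" for x using assms by (simp add: primitive_of_def)
    have "continuous_on {a..b} (\<lambda>x. F a + integral {a..x} H)"
      by (intro continuous_intros indefinite_integral_continuous_1 set_borel_integral_eq_integral(1)[OF H])
    moreover have "F a + integral {a..x} H = F x" if "x \<in> {a..b}" for x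
    proof -
      have "F x - F a = integral {a..x} H"
        using assms that set_borel_integral_eq_integral(2)[OF H, of x] by (simp add: primitive_of_def)
      then show ?thesis by (simp add: algebra_simps)
    qed
    ultimately have "continuous_on {a..b} F" by (metis (no_types, lifting) continuous_on_cong)
    then show ?thesis by (rule continuous_on_subset) auto
  qed auto
  then have "isCont F x" for x
    by (metis continuous_on_eq_continuous_at greaterThanLessThan_iff open_greaterThanLessThan gt_ex lt_ex)
  then show ?thesis by (simp add: continuous_at_imp_continuous_on)
qed

text \<open>The increment of \<open>F\<close> across the band \<open>l < norm (F s) < 2 * l\<close> is at least \<open>l\<close>, and only the values of \<open>H\<close> on the part
of the interval where \<open>F\<close> is inside the band contribute to it. Keeping this localisation is what later
allows the contributions of different levels to be added.\<close>

lemma level_crossing_cost: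
  fixes F H :: "real \<Rightarrow> complex"
  assumes p: "1 \<le> p" and prim: "primitive_of F H"
    and Hp: "integrable lborel (\<lambda>s. norm (H s) powr p)"
    and x: "x \<in> {a..b}" "2 * l \<le> norm (F x)" and y: "y \<in> {a..b}" "norm (F y) \<le> l" and l: "0 < l"
  shows "l powr p \<le> (b - a) powr (p - 1) *
    (LINT s:({a<..<b} \<inter> {s. l < norm (F s) \<and> norm (F s) < 2 * l})|lborel. norm (H s) powr p)"
proof -
  have cont: "continuous_on S F" for S using prim by (rule primitive_of_continuous)
  obtain c d where cd: "a \<le> c" "c \<le> d" "d \<le> b"
    and jump: "l \<le> norm (F d - F c)"
    and between: "\<And>s. c < s \<Longrightarrow> s < d \<Longrightarrow> l < norm (F s) \<and> norm (F s) < 2 * l"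
  proof (cases "x \<le> y")
    case True
    have "continuous_on {x..y} (\<lambda>s. norm (F s))" by (intro continuous_intros cont)
    then obtain c d where "x \<le> c" "c \<le> d" "d \<le> y" "norm (F c) = 2 * l" "norm (F d) = l"
        "\<And>s. c < s \<Longrightarrow> s < d \<Longrightarrow> l < norm (F s) \<and> norm (F s) < 2 * l"
      using crossing_interval[of x y "\<lambda>s. norm (F s)" "2 * l" l] True x y l by auto
    then show ?thesis
      using that[of c d] x y norm_triangle_ineq2[of "F c" "F d"] by (auto simp: norm_minus_commute)
  next
    case False
    have "continuous_on {y..x} (\<lambda>s. - norm (F s))" by (intro continuous_intros cont)
    then obtain c d where "y \<le> c" "c \<le> d" "d \<le> x" "- norm (F c) = - l" "- norm (F d) = - (2 * l)"
        "\<And>s. c < s \<Longrightarrow> s < d \<Longrightarrow> - (2 * l) < - norm (F s) \<and> - norm (F s) < - l"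
      using crossing_interval[of y x "\<lambda>s. - norm (F s)" "- l" "- (2 * l)"] False x y l by auto
    then show ?thesis
      using that[of c d] x y norm_triangle_ineq2[of "F d" "F c"] by (auto simp: norm_minus_commute)
  qed
  define I where "I = {c<..<d}"
  have Imeas: "I \<inter> space lborel \<in> sets lborel" by (simp add: I_def)
  interpret I: finite_measure "restrict_space lborel I"
    by (rule finite_measureI) (simp add: emeasure_restrict_space I_def cd)
  have Hcd: "set_integrable lborel {c..d} H" using prim by (simp add: primitive_of_def)
  then have HI: "set_integrable lborel I H" by (rule set_integrable_subset) (auto simp: I_def)
  then have intI: "integrable (restrict_space lborel I) (\<lambda>s. norm (H s))"
    by (intro integrable_norm) (simp add: integrable_restrict_space[OF Imeas] set_integrable_def)
  have intIp: "integrable (restrict_space lborel I) (\<lambda>s. norm (H s) powr p)"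
    using integrable_mult_indicator[OF _ Hp, of I] Imeas by (simp add: integrable_restrict_space[OF Imeas])
  \<comment> \<open>From the increment to \<open>H\<close> itself, and from the first to the \<open>p\<close>-th power at the cost of the length of the interval.\<close>
  have "l \<le> norm (F d - F c)" by (rule jump)
  also have "F d - F c = (LINT s:{c..d}|lborel. H s)" using prim cd by (simp add: primitive_of_def)
  also have "\<dots> = (LINT s:I|lborel. H s)"
    unfolding I_def by (rule set_integral_discrete_difference[where X="{c,d}"]) auto
  also have "norm \<dots> \<le> (LINT s:I|lborel. norm (H s))"
    using HI by (rule set_integral_norm_bound)
  also have "\<dots> = (\<integral>s. norm (H s) \<partial>restrict_space lborel I)"
    by (simp add: integral_restrict_space[OF Imeas] set_lebesgue_integral_def)
  finally have "l powr p \<le> (\<integral>s. norm (H s) \<partial>restrict_space lborel I) powr p"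
    using l p by (intro powr_mono2) auto
  also have "\<dots> \<le> measure (restrict_space lborel I) (space (restrict_space lborel I)) powr (p - 1) *
      (\<integral>s. norm (H s) powr p \<partial>restrict_space lborel I)"
    by (rule I.integral_powr_le[OF p intI intIp]) simp
  also have "measure (restrict_space lborel I) (space (restrict_space lborel I)) = d - c"
    using cd by (simp add: measure_restrict_space I_def)
  also have "(d - c) powr (p - 1) * (\<integral>s. norm (H s) powr p \<partial>restrict_space lborel I)
     \<le> (b - a) powr (p - 1) *
    (LINT s:({a<..<b} \<inter> {s. l < norm (F s) \<and> norm (F s) < 2 * l})|lborel. norm (H s) powr p)"
  proof (rule mult_mono)
    have "open {s. l < norm (F s) \<and> norm (F s) < 2 * l}"
      by (intro open_Collect_conj open_Collect_less continuous_intros cont)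
    then have meas: "{a<..<b} \<inter> {s. l < norm (F s) \<and> norm (F s) < 2 * l} \<in> sets lborel"
      by auto
    have sub: "I \<subseteq> {a<..<b} \<inter> {s. l < norm (F s) \<and> norm (F s) < 2 * l}"
      using between cd by (auto simp: I_def)
    have "(LINT s:I|lborel. norm (H s) powr p) \<le>
      (LINT s:({a<..<b} \<inter> {s. l < norm (F s) \<and> norm (F s) < 2 * l})|lborel. norm (H s) powr p)"
      unfolding set_lebesgue_integral_def
      by (intro integral_mono integrable_mult_indicator Hp meas mult_right_mono)
         (use sub Imeas in \<open>auto simp: indicator_def\<close>)
    then show "(\<integral>s. norm (H s) powr p \<partial>restrict_space lborel I) \<le>
      (LINT s:({a<..<b} \<inter> {s. l < norm (F s) \<and> norm (F s) < 2 * l})|lborel. norm (H s) powr p)"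
      by (simp add: integral_restrict_space[OF Imeas] set_lebesgue_integral_def)
  qed (use cd p in \<open>auto intro!: powr_mono2\<close>)
  finally show ?thesis .
qed

section \<open>Interpolation on the line\<close>

text \<open>The line is cut into cells of the length \<open>h\<close> for which the low points supplied by the hypothesis lie
at height at most \<open>l\<close>, namely \<open>h = (M / l) powr ((q - p) / p)\<close>. A cell that meets the superlevel set then
contains both a point above \<open>2 * l\<close> and a point below \<open>l\<close>, so it pays the price of a level crossing. The measure of the
superlevel set is at most the total length of the cells that it meets, and
\<open>h powr p * l powr (- p) = M powr (q - p) * l powr (- q)\<close>.\<close>

lemma superlevel_measure_le:
  fixes F H :: "real \<Rightarrow> complex"
  assumes p: "1 \<le> p" and pq: "p < q" and prim: "primitive_of F H"
    and Hp: "integrable lborel (\<lambda>s. norm (H s) powr p)" and M: "0 < M"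
    and low: "\<And>a h. 0 < h \<Longrightarrow> \<exists>s\<in>{a..a+h}. norm (F s) \<le> M * h powr (- (p / (q - p)))"
    and l: "0 < l"
  shows "emeasure lborel {s. 2 * l \<le> norm (F s)} \<le> ennreal (M powr (q - p) * l powr (- q)) *
    emeasure (density lborel (\<lambda>s. ennreal (norm (H s) powr p))) {s. l < norm (F s) \<and> norm (F s) < 2 * l}"
proof -
  have cont: "continuous_on S F" for S using prim by (rule primitive_of_continuous)
  define N where "N = density lborel (\<lambda>s. ennreal (norm (H s) powr p))"
  define A where "A = {s. 2 * l \<le> norm (F s)}"
  define B where "B = {s. l < norm (F s) \<and> norm (F s) < 2 * l}"
  define K where "K = M powr (q - p) * l powr (- q)"
  have "closed A" unfolding A_def by (intro closed_Collect_le continuous_intros cont)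
  then have A[measurable]: "A \<in> sets borel" by auto
  have "open B" unfolding B_def by (intro open_Collect_conj open_Collect_less continuous_intros cont)
  then have B[measurable]: "B \<in> sets borel" by auto
  have Hm[measurable]: "(\<lambda>s. norm (H s) powr p) \<in> borel_measurable borel"
    using Hp by auto
  define h where "h = (M / l) powr ((q - p) / p)"
  have h: "0 < h" using M l by (simp add: h_def)
  have hlow: "M * h powr (- (p / (q - p))) = l"
    using M l p pq by (simp add: h_def powr_powr powr_minus)
  \<comment> \<open>The choice of \<open>h\<close> turns the decay rate \<open>p / (q - p)\<close> of the low points into the exponents of the estimate.\<close>
  have hK: "h powr p * l powr (- p) = K"
  proof -
    have "h powr p = M powr (q - p) / l powr (q - p)"
      using M l p pq by (simp add: h_def powr_powr powr_divide)
    moreover have "l powr (- q) = l powr (- p) / l powr (q - p)"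
      using l by (simp flip: powr_diff)
    ultimately show ?thesis by (simp add: K_def)
  qed
  have K0: "0 \<le> K" by (simp add: K_def)
  define I where "I j = {of_int j * h ..< (of_int j + 1) * h}" for j :: int
  have I[measurable]: "I j \<in> sets borel" for j by (simp add: I_def)
  have disj: "disjoint_family I"
  proof (unfold disjoint_family_on_def, safe)
    fix i j x assume "i \<noteq> j" "x \<in> I i" "x \<in> I j"
    then have "\<lfloor>x / h\<rfloor> = i" "\<lfloor>x / h\<rfloor> = j"
      using h by (auto simp: I_def floor_eq_iff field_simps)
    then show "x \<in> {}" using \<open>i \<noteq> j\<close> by simp
  qed
  have cover: "(\<Union>j. I j) = UNIV"
  proof safe
    fix x :: real
    have "of_int \<lfloor>x / h\<rfloor> * h \<le> x / h * h" "x / h * h < (of_int \<lfloor>x / h\<rfloor> + 1) * h"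
      using h by (intro mult_right_mono mult_strict_right_mono; simp)+
    then have "x \<in> I \<lfloor>x / h\<rfloor>" using h by (simp add: I_def)
    then show "x \<in> (\<Union>j. I j)" by blast
  qed auto
  have cell: "emeasure lborel (A \<inter> I j) \<le> ennreal K * emeasure N (B \<inter> I j)" for j
  proof (cases "A \<inter> I j = {}")
    case False
    define a where "a = of_int j * h"
    have Ij: "I j = {a..<a+h}" by (simp add: I_def a_def algebra_simps)
    obtain x where "x \<in> A" "x \<in> I j" using False by blast
    then have x: "x \<in> {a..a+h}" "2 * l \<le> norm (F x)" by (auto simp: A_def Ij)
    obtain y where y: "y \<in> {a..a+h}" "norm (F y) \<le> l" using low[OF h, of a] hlow by auto
    define J where "J = (LINT s:({a<..<a+h} \<inter> B)|lborel. norm (H s) powr p)"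
    have cost: "l powr p \<le> h powr (p - 1) * J"
      using level_crossing_cost[OF p prim Hp x y l] by (simp add: J_def B_def)
    have "h = K * (h powr (1 - p) * l powr p)"
    proof -
      have "K * (h powr (1 - p) * l powr p) = (h powr p * h powr (1 - p)) * (l powr (- p) * l powr p)"
        by (simp add: hK[symmetric])
      also have "h powr p * h powr (1 - p) = h" using h by (simp flip: powr_add)
      also have "l powr (- p) * l powr p = 1" using l by (simp flip: powr_add)
      finally show ?thesis by simp
    qed
    also have "\<dots> \<le> K * (h powr (1 - p) * (h powr (p - 1) * J))"
      using cost K0 by (intro mult_left_mono) auto
    also have "h powr (1 - p) * (h powr (p - 1) * J) = J"
      using h by (simp flip: powr_add mult.assoc)
    finally have hJ: "h \<le> K * J" .
    have "J = (\<integral>s. indicator ({a<..<a+h} \<inter> B) s * norm (H s) powr p \<partial>lborel)"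
      by (simp add: J_def set_lebesgue_integral_def)
    then have "ennreal J = (\<integral>\<^sup>+s. ennreal (indicator ({a<..<a+h} \<inter> B) s * norm (H s) powr p) \<partial>lborel)"
      using integrable_mult_indicator[OF _ Hp, of "{a<..<a+h} \<inter> B"]
      by (simp add: nn_integral_eq_integral)
    also have "\<dots> \<le> (\<integral>\<^sup>+s. ennreal (norm (H s) powr p) * indicator (B \<inter> I j) s \<partial>lborel)"
      by (intro nn_integral_mono) (auto simp: Ij indicator_def)
    also have "\<dots> = emeasure N (B \<inter> I j)"
      by (simp add: N_def emeasure_density)
    finally have "ennreal J \<le> emeasure N (B \<inter> I j)" .
    then have JN: "ennreal K * ennreal J \<le> ennreal K * emeasure N (B \<inter> I j)" by (rule mult_left_mono) simp
    have "emeasure lborel (A \<inter> I j) \<le> emeasure lborel (I j)" by (intro emeasure_mono) auto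
    also have "\<dots> = ennreal h" using h by (simp add: Ij)
    also have "\<dots> \<le> ennreal (K * J)" using hJ by (intro ennreal_leI)
    also have "\<dots> = ennreal K * ennreal J" using K0 by (simp add: ennreal_mult')
    finally show ?thesis using JN by (rule order_trans)
  qed auto
  have "emeasure lborel A = emeasure lborel (\<Union>j. A \<inter> I j)" using cover by (simp flip: Int_UN_distrib)
  also have "\<dots> = (\<integral>\<^sup>+j. emeasure lborel (A \<inter> I j) \<partial>count_space UNIV)"
    by (intro emeasure_UN_countable) (use disj in \<open>auto simp: disjoint_family_on_def\<close>)
  also have "\<dots> \<le> (\<integral>\<^sup>+j. ennreal K * emeasure N (B \<inter> I j) \<partial>count_space UNIV)"
    by (intro nn_integral_mono cell)
  also have "\<dots> = ennreal K * (\<integral>\<^sup>+j. emeasure N (B \<inter> I j) \<partial>count_space UNIV)"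
    by (simp add: nn_integral_cmult)
  also have "(\<integral>\<^sup>+j. emeasure N (B \<inter> I j) \<partial>count_space UNIV) = emeasure N (\<Union>j. B \<inter> I j)"
    by (intro emeasure_UN_countable[symmetric]) (use disj in \<open>auto simp: disjoint_family_on_def N_def\<close>)
  also have "(\<Union>j. B \<inter> I j) = B" using cover by (simp flip: Int_UN_distrib)
  finally show ?thesis by (simp add: A_def B_def N_def K_def)
qed

text \<open>The dyadic bands \<open>S k\<close> partition the set where \<open>F\<close> does not vanish. On \<open>S (k + 1)\<close> the integrand is at most
\<open>(4 * 2 powr k) powr q\<close>, which the factor \<open>l powr (- q)\<close> in the bound for the superlevel set at \<open>l = 2 powr k\<close> cancels. What
remains is a constant times the integral of \<open>norm (H s) powr p\<close> over \<open>S k\<close>, and these sets are disjoint.\<close>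

lemma nn_integral_powr_le_of_low_points:
  fixes F H :: "real \<Rightarrow> complex"
  assumes p: "1 \<le> p" and pq: "p < q" and prim: "primitive_of F H"
    and Hp: "integrable lborel (\<lambda>s. norm (H s) powr p)" and M: "0 < M"
    and low: "\<And>a h. 0 < h \<Longrightarrow> \<exists>s\<in>{a..a+h}. norm (F s) \<le> M * h powr (- (p / (q - p)))"
  shows "(\<integral>\<^sup>+s. ennreal (norm (F s) powr q) \<partial>lborel) \<le>
    ennreal (4 powr q * M powr (q - p)) * (\<integral>\<^sup>+s. ennreal (norm (H s) powr p) \<partial>lborel)"
proof -
  have cont: "continuous_on S F" for S using prim by (rule primitive_of_continuous)
  have "continuous_on UNIV F" by (rule cont)
  then have Fm[measurable]: "F \<in> borel_measurable borel" by (rule borel_measurable_continuous_onI)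
  have Hm[measurable]: "(\<lambda>s. norm (H s) powr p) \<in> borel_measurable borel"
    using Hp by auto
  define N where "N = density lborel (\<lambda>s. ennreal (norm (H s) powr p))"
  define Q where "Q = density lborel (\<lambda>s. ennreal (norm (F s) powr q))"
  define S where "S k = {s. 2 powr of_int k \<le> norm (F s) \<and> norm (F s) < 2 * 2 powr of_int k}" for k :: int
  have S[measurable]: "S k \<in> sets borel" for k unfolding S_def by measurable
  have Siff: "s \<in> S k \<longleftrightarrow> F s \<noteq> 0 \<and> \<lfloor>log 2 (norm (F s))\<rfloor> = k" for s k
  proof (cases "F s = 0")
    case False
    have "2 * 2 powr real_of_int k = 2 powr (real_of_int k + 1)" by (simp add: powr_add)
    then show ?thesis using False by (simp add: S_def floor_eq_iff le_log_iff log_less_iff)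
  qed (simp add: S_def not_le)
  have disj: "disjoint_family S" by (auto simp: disjoint_family_on_def Siff)
  have cover: "(\<Union>k. S k) = {s. F s \<noteq> 0}" using Siff by blast
  define C where "C = 4 powr q * M powr (q - p)"
  have step: "emeasure Q (S (k + 1)) \<le> ennreal C * emeasure N (S k)" for k
  proof -
    define l where "l = 2 powr real_of_int k"
    have l: "0 < l" by (simp add: l_def)
    have Sk1: "S (k + 1) = {s. 2 * l \<le> norm (F s) \<and> norm (F s) < 4 * l}"
      by (simp add: S_def l_def powr_add mult.commute)
    have "emeasure Q (S (k + 1)) = (\<integral>\<^sup>+s. ennreal (norm (F s) powr q) * indicator (S (k + 1)) s \<partial>lborel)"
      by (simp add: Q_def emeasure_density)
    also have "\<dots> \<le> (\<integral>\<^sup>+s. ennreal ((4 * l) powr q) * indicator {s. 2 * l \<le> norm (F s)} s \<partial>lborel)"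
      by (intro nn_integral_mono)
         (use p pq in \<open>auto simp: Sk1 indicator_def intro!: ennreal_leI powr_mono2\<close>)
    also have "\<dots> = ennreal ((4 * l) powr q) * emeasure lborel {s. 2 * l \<le> norm (F s)}"
      by (intro nn_integral_cmult_indicator) measurable
    also have "\<dots> \<le> ennreal ((4 * l) powr q) * (ennreal (M powr (q - p) * l powr (- q)) *
        emeasure N {s. l < norm (F s) \<and> norm (F s) < 2 * l})"
      unfolding N_def by (intro mult_left_mono superlevel_measure_le p pq prim Hp M low l) auto
    also have "\<dots> = ennreal ((4 * l) powr q * (M powr (q - p) * l powr (- q))) *
        emeasure N {s. l < norm (F s) \<and> norm (F s) < 2 * l}"
      by (simp add: ennreal_mult mult.assoc)
    also have "(4 * l) powr q * (M powr (q - p) * l powr (- q)) = C"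
      using l by (simp add: C_def powr_mult powr_minus field_simps)
    also have "emeasure N {s. l < norm (F s) \<and> norm (F s) < 2 * l} \<le> emeasure N (S k)"
      by (intro emeasure_mono) (auto simp: S_def l_def N_def)
    finally show ?thesis by (simp add: mult_left_mono)
  qed
  have "(\<integral>\<^sup>+s. ennreal (norm (F s) powr q) \<partial>lborel) = emeasure Q {s. F s \<noteq> 0}"
    by (auto simp: Q_def emeasure_density indicator_def intro!: nn_integral_cong)
  also have "\<dots> = (\<integral>\<^sup>+k. emeasure Q (S k) \<partial>count_space UNIV)"
    unfolding cover[symmetric] by (intro emeasure_UN_countable disj) (auto simp: Q_def)
  also have "\<dots> = (\<integral>\<^sup>+k. emeasure Q (S (k + 1)) \<partial>count_space UNIV)"
    by (intro nn_integral_bij_count_space[symmetric]) (auto intro!: bij_betwI[where g="\<lambda>k. k - 1"])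
  also have "\<dots> \<le> (\<integral>\<^sup>+k. ennreal C * emeasure N (S k) \<partial>count_space UNIV)"
    by (intro nn_integral_mono step)
  also have "\<dots> = ennreal C * emeasure N (\<Union>k. S k)"
    by (subst emeasure_UN_countable) (auto simp: nn_integral_cmult disj N_def)
  also have "\<dots> \<le> ennreal C * emeasure N (space N)"
    by (intro mult_left_mono emeasure_mono) (auto simp: N_def)
  also have "emeasure N (space N) = (\<integral>\<^sup>+s. ennreal (norm (H s) powr p) \<partial>lborel)"
    by (simp add: N_def emeasure_density)
  finally show ?thesis by (simp add: C_def)
qed

section \<open>Test functions\<close>

text \<open>On the real line the only basis vector is \<open>1\<close>, so iterated partial derivatives are indexed by their order.\<close>

lemma pderivs_real_eq_replicate:
  fixes f :: "real \<Rightarrow> complex"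
  shows "set vs \<subseteq> Basis \<Longrightarrow> pderivs vs f = pderivs (replicate (length vs) 1) f"
  by (induction vs) auto

definition has_derivs :: "(real \<Rightarrow> complex) \<Rightarrow> (nat \<Rightarrow> real \<Rightarrow> complex) \<Rightarrow> bool" where
  "has_derivs f D \<longleftrightarrow> D 0 = f \<and> (\<forall>n x. (D n has_vector_derivative D (Suc n) x) (at x))"

lemma has_derivs_pderivs:
  assumes "has_derivs f D"
  shows "pderivs (replicate n 1) f = D n"
proof (induction n)
  case (Suc n)
  have "frechet_derivative (D n) (at x) 1 = D (Suc n) x" for x
  proof -
    have "(D n has_derivative (\<lambda>y. y *\<^sub>R D (Suc n) x)) (at x)"
      using assms by (simp add: has_derivs_def has_vector_derivative_def)
    from frechet_derivative_at[OF this, symmetric] show ?thesis by simp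
  qed
  then show ?case using Suc by simp
qed (use assms in \<open>simp add: has_derivs_def\<close>)

lemma smooth_on_real_iff: "smooth_on UNIV f \<longleftrightarrow> (\<exists>D. has_derivs f D)"
proof
  assume s: "smooth_on UNIV f"
  define D where "D n = pderivs (replicate n 1) f" for n
  have "(D n has_vector_derivative D (Suc n) x) (at x)" for n x
  proof -
    have "set (replicate n (1::real)) \<subseteq> Basis" by auto
    then have "D n differentiable (at x)"
      using s unfolding smooth_on_def D_def by blast
    then have *: "(D n has_derivative frechet_derivative (D n) (at x)) (at x)"
      by (simp add: frechet_derivative_works)
    have "frechet_derivative (D n) (at x) y = y *\<^sub>R D (Suc n) x" for y
      using linear_scale[OF has_derivative_linear[OF *], of y 1] by (simp add: D_def)
    then have "frechet_derivative (D n) (at x) = (\<lambda>y. y *\<^sub>R D (Suc n) x)" ..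
    then show ?thesis using * by (simp add: has_vector_derivative_def)
  qed
  then show "\<exists>D. has_derivs f D" unfolding has_derivs_def by (intro exI[of _ D]) (auto simp: D_def)
next
  assume "\<exists>D. has_derivs f D"
  then obtain D where D: "has_derivs f D" by blast
  have "D n differentiable (at x)" for n x
    using D unfolding has_derivs_def differentiable_def has_vector_derivative_def by blast
  then show "smooth_on UNIV f"
    by (simp add: smooth_on_def pderivs_real_eq_replicate has_derivs_pderivs[OF D])
qed

lemma derivative_zero_outside:
  fixes f :: "real \<Rightarrow> complex"
  assumes d: "\<And>x. (f has_vector_derivative f' x) (at x)" and supp: "\<And>x. R < \<bar>x\<bar> \<Longrightarrow> f x = 0"
    and x: "R < \<bar>x\<bar>"
  shows "f' x = 0"
proof -
  have "open {x::real. R < \<bar>x\<bar>}" by (intro open_Collect_less continuous_intros)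
  then have "(f has_vector_derivative 0) (at x)"
    by (rule has_vector_derivative_transform_within_open[OF has_vector_derivative_const])
       (use x supp in auto)
  then show ?thesis using d vector_derivative_unique_at by blast
qed

text \<open>Smoothness by closure: no formula for the higher derivatives is needed if the derivative of each member of a
class of functions is again in the class.\<close>

lemma has_derivs_of_closed_class:
  assumes f: "f \<in> A" and closed: "\<And>f. f \<in> A \<Longrightarrow> \<exists>f'\<in>A. \<forall>x. (f has_vector_derivative f' x) (at x)"
  shows "\<exists>D. has_derivs f D"
proof -
  have "\<forall>f\<in>A. \<exists>f'. f' \<in> A \<and> (\<forall>x. (f has_vector_derivative f' x) (at x))"
    using closed by blast
  from bchoice[OF this] obtain d
    where d: "\<forall>f\<in>A. d f \<in> A \<and> (\<forall>x. (f has_vector_derivative d f x) (at x))" ..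
  have "(d ^^ n) f \<in> A" for n by (induction n) (use f d in auto)
  then have "has_derivs f (\<lambda>n. (d ^^ n) f)" using d by (auto simp: has_derivs_def)
  then show ?thesis by blast
qed

text \<open>The powers \<open>x ^ m\<close> in the denominator arise from differentiating \<open>exp (- 1 / x)\<close>; with them the family spans a
space that is closed under differentiation.\<close>

definition flat :: "nat \<Rightarrow> real \<Rightarrow> real" where
  "flat m x = (if 0 < x then exp (- 1 / x) / x ^ m else 0)"

lemma flat_tendsto_0: "(flat m \<longlongrightarrow> 0) (at 0)"
proof -
  have "((\<lambda>y::real. y ^ m / exp y) \<longlongrightarrow> 0) at_top" by (rule tendsto_power_div_exp_0)
  then have "((\<lambda>x::real. inverse x ^ m / exp (inverse x)) \<longlongrightarrow> 0) (at_right 0)"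
    by (rule filterlim_compose) (rule filterlim_inverse_at_top_right)
  moreover have "eventually (\<lambda>x. inverse x ^ m / exp (inverse x) = flat m x) (at_right 0)"
    unfolding eventually_at_right_field
    by (auto simp: flat_def exp_minus field_simps intro!: exI[of _ 1])
  ultimately have "(flat m \<longlongrightarrow> 0) (at_right 0)" by (rule Lim_transform_eventually)
  moreover have "(flat m \<longlongrightarrow> 0) (at_left 0)"
    by (rule Lim_transform_eventually[OF tendsto_const])
       (auto simp: eventually_at_left_field flat_def intro!: exI[of _ "-1"])
  ultimately show ?thesis by (simp add: filterlim_at_split)
qed

text \<open>At the origin the difference quotient of \<open>flat m\<close> is \<open>flat (m + 1)\<close>, which tends to \<open>0\<close>.\<close>

lemma flat_deriv: "(flat m has_real_derivative flat (m + 2) x - m * flat (m + 1) x) (at x)"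
proof -
  consider "0 < x" | "x = 0" | "x < 0" by linarith
  then show ?thesis
  proof cases
    case 1
    have "((\<lambda>x. exp (- 1 / x) / x ^ m) has_real_derivative
        (exp (- 1 / x) * (1 / (x * x)) * x ^ m - exp (- 1 / x) * (m * x ^ (m - 1))) / (x ^ m * x ^ m)) (at x)"
      using 1 by (auto intro!: derivative_eq_intros simp: power2_eq_square)
    moreover have "(exp (- 1 / x) * (1 / (x * x)) * x ^ m - exp (- 1 / x) * (m * x ^ (m - 1))) / (x ^ m * x ^ m)
        = flat (m + 2) x - m * flat (m + 1) x"
      using 1 by (cases m) (simp_all add: flat_def field_simps)
    ultimately have "((\<lambda>x. exp (- 1 / x) / x ^ m) has_real_derivative
        flat (m + 2) x - m * flat (m + 1) x) (at x)" by simp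
    then show ?thesis
      by (rule has_field_derivative_transform_within_open[where S="{0<..}"]) (use 1 in \<open>auto simp: flat_def\<close>)
  next
    case 2
    have "(\<lambda>y. (flat m y - flat m 0) / (y - 0)) = flat (m + 1)"
      by (auto simp: flat_def fun_eq_iff)
    then show ?thesis using 2 flat_tendsto_0[of "m + 1"]
      by (simp add: has_field_derivative_iff flat_def[of _ 0])
  next
    case 3
    have "((\<lambda>x. 0) has_real_derivative flat (m + 2) x - m * flat (m + 1) x) (at x)"
      using 3 by (simp add: flat_def)
    then show ?thesis
      by (rule has_field_derivative_transform_within_open[where S="{..<0}"])
         (use 3 in \<open>auto simp: flat_def\<close>)
  qed
qed

text \<open>Closed under differentiation by the product rule, and rich enough to contain smooth approximations of the indicators
of intervals.\<close>

inductive_set flat_algebra :: "(real \<Rightarrow> complex) set" where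
  flat: "(\<lambda>x. of_real (flat m (\<alpha> * x + \<beta>))) \<in> flat_algebra"
| scale: "f \<in> flat_algebra \<Longrightarrow> (\<lambda>x. c * f x) \<in> flat_algebra"
| add: "f \<in> flat_algebra \<Longrightarrow> g \<in> flat_algebra \<Longrightarrow> (\<lambda>x. f x + g x) \<in> flat_algebra"
| mult: "f \<in> flat_algebra \<Longrightarrow> g \<in> flat_algebra \<Longrightarrow> (\<lambda>x. f x * g x) \<in> flat_algebra"

lemma flat_algebra_deriv:
  "f \<in> flat_algebra \<Longrightarrow> \<exists>f'\<in>flat_algebra. \<forall>x. (f has_vector_derivative f' x) (at x)"
proof (induction rule: flat_algebra.induct)
  case (flat m \<alpha> \<beta>)
  let ?g = "\<lambda>k x. complex_of_real (flat k (\<alpha> * x + \<beta>))"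
  let ?f' = "\<lambda>x. complex_of_real \<alpha> * (?g (m + 2) x + complex_of_real (- real m) * ?g (m + 1) x)"
  have "((\<lambda>x. ?g m x) has_vector_derivative ?f' x) (at x)" for x
  proof -
    have "((\<lambda>x. \<alpha> * x + \<beta>) has_real_derivative \<alpha>) (at x)"
      by (auto intro!: derivative_eq_intros)
    from DERIV_chain2[OF flat_deriv this] have "((\<lambda>x. flat m (\<alpha> * x + \<beta>)) has_real_derivative
        (flat (m + 2) (\<alpha> * x + \<beta>) - m * flat (m + 1) (\<alpha> * x + \<beta>)) * \<alpha>) (at x)"
      .
    then have "((\<lambda>x. ?g m x) has_vector_derivative complex_of_real
        ((flat (m + 2) (\<alpha> * x + \<beta>) - m * flat (m + 1) (\<alpha> * x + \<beta>)) * \<alpha>)) (at x)"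
      by (rule has_vector_derivative_of_real)
    moreover have "complex_of_real
        ((flat (m + 2) (\<alpha> * x + \<beta>) - m * flat (m + 1) (\<alpha> * x + \<beta>)) * \<alpha>) = ?f' x"
      by simp
    ultimately show ?thesis by (simp only:)
  qed
  moreover have "?f' \<in> flat_algebra"
    using flat_algebra.scale[OF flat_algebra.add[OF flat_algebra.flat[of "m + 2" \<alpha> \<beta>]
        flat_algebra.scale[OF flat_algebra.flat[of "m + 1" \<alpha> \<beta>], of "complex_of_real (- real m)"]],
        of "complex_of_real \<alpha>"] .
  ultimately show ?case by (intro bexI[of _ ?f'] allI)
next
  case (scale f c)
  then obtain f' where f': "f' \<in> flat_algebra" "\<And>x. (f has_vector_derivative f' x) (at x)" by blast
  have "((\<lambda>x. c * f x) has_vector_derivative c * f' x) (at x)" for x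
    by (rule has_vector_derivative_mult_right[OF f'(2)])
  then show ?case by (intro bexI[OF _ flat_algebra.scale[OF f'(1)]] allI)
next
  case (add f g)
  then obtain f' g' where f': "f' \<in> flat_algebra" "\<And>x. (f has_vector_derivative f' x) (at x)"
    and g': "g' \<in> flat_algebra" "\<And>x. (g has_vector_derivative g' x) (at x)" by blast
  show ?case
    by (intro bexI[OF _ flat_algebra.add[OF f'(1) g'(1)]] allI has_vector_derivative_add f'(2) g'(2))
next
  case (mult f g)
  then obtain f' g' where f': "f' \<in> flat_algebra" "\<And>x. (f has_vector_derivative f' x) (at x)"
    and g': "g' \<in> flat_algebra" "\<And>x. (g has_vector_derivative g' x) (at x)" by blast
  show ?case
    by (intro bexI[OF _ flat_algebra.add[OF flat_algebra.mult[OF mult.hyps(1) g'(1)]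
          flat_algebra.mult[OF f'(1) mult.hyps(2)]]] allI has_vector_derivative_mult f'(2) g'(2))
qed

lemma flat_algebra_smooth: "f \<in> flat_algebra \<Longrightarrow> smooth_on UNIV f"
  unfolding smooth_on_real_iff by (rule has_derivs_of_closed_class[where A=flat_algebra, OF _ flat_algebra_deriv])

text \<open>A smooth function supported on \<open>{a..b}\<close> that tends to the indicator of \<open>{a<..<b}\<close> as \<open>k\<close> grows: the factor \<open>Suc k\<close>
steepens both flanks. The arguments are written as affine functions so that \<open>bump k a b\<close> is visibly in \<open>flat_algebra\<close>.\<close>

definition bump :: "nat \<Rightarrow> real \<Rightarrow> real \<Rightarrow> real \<Rightarrow> complex" where
  "bump k a b x = of_real (flat 0 (real (Suc k) * x + - real (Suc k) * a)) *
     of_real (flat 0 (- real (Suc k) * x + real (Suc k) * b))"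

lemma bump_in_flat_algebra: "bump k a b \<in> flat_algebra"
  using flat_algebra.mult[OF flat_algebra.flat[of 0 "real (Suc k)" "- real (Suc k) * a"]
      flat_algebra.flat[of 0 "- real (Suc k)" "real (Suc k) * b"]]
  by (simp only: bump_def[abs_def])

lemma bump_eq:
  "bump k a b x = (if a < x \<and> x < b then
     of_real (exp (- 1 / (real (Suc k) * (x - a))) * exp (- 1 / (real (Suc k) * (b - x)))) else 0)"
proof -
  have "0 < real (Suc k) * x + - real (Suc k) * a \<longleftrightarrow> a < x"
    "0 < - real (Suc k) * x + real (Suc k) * b \<longleftrightarrow> x < b"
    by (simp_all del: of_nat_Suc)
  moreover have "real (Suc k) * x + - real (Suc k) * a = real (Suc k) * (x - a)"
     "- real (Suc k) * x + real (Suc k) * b = real (Suc k) * (b - x)"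
    by (simp_all add: algebra_simps)
  ultimately show ?thesis unfolding bump_def flat_def by simp
qed

lemma bump_norm_le: "norm (bump k a b x) \<le> 1"
  by (auto simp: bump_eq norm_mult intro!: mult_le_one simp del: of_nat_Suc)

lemma bump_tendsto: "(\<lambda>k. bump k a b x) \<longlonglongrightarrow> indicator {a<..<b} x"
proof (cases "a < x \<and> x < b")
  case True
  have lim: "(\<lambda>k. exp (- 1 / (real (Suc k) * c))) \<longlonglongrightarrow> 1" if "0 < c" for c
  proof -
    have "(\<lambda>k. inverse (real (Suc k)) * (- 1 / c)) \<longlonglongrightarrow> 0 * (- 1 / c)"
      by (intro tendsto_intros LIMSEQ_inverse_real_of_nat)
    then have "(\<lambda>k. - 1 / (real (Suc k) * c)) \<longlonglongrightarrow> 0"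
      by (simp add: field_simps)
    from tendsto_exp[OF this] show ?thesis by simp
  qed
  have "(\<lambda>k. complex_of_real (exp (- 1 / (real (Suc k) * (x - a))) * exp (- 1 / (real (Suc k) * (b - x)))))
      \<longlonglongrightarrow> complex_of_real (1 * 1)"
    using True by (intro tendsto_of_real tendsto_mult lim) auto
  then show ?thesis using True by (simp add: bump_eq)
qed (auto simp: bump_eq)

lemma bump_measurable[measurable]: "bump k a b \<in> borel_measurable borel"
  unfolding bump_eq[abs_def] by measurable

lemma integral_bump_nonzero: "\<exists>k. (LINT x|lborel. bump k 0 1 x) \<noteq> 0"
proof -
  have "(\<lambda>k. LINT x|lborel. bump k 0 1 x) \<longlonglongrightarrow> (LINT x|lborel. indicator {0<..<1::real} x *\<^sub>R (1::complex))"
  proof (rule integral_dominated_convergence)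
    show "integrable lborel (indicator {0..1::real} :: real \<Rightarrow> real)"
      by (simp add: integrable_indicator_iff)
    show "AE x in lborel. (\<lambda>k. bump k 0 1 x) \<longlonglongrightarrow> indicator {0<..<1::real} x *\<^sub>R (1::complex)"
    proof (rule AE_I2)
      fix x :: real
      have "indicator {0<..<1::real} x *\<^sub>R (1::complex) = indicator {0<..<1} x" by (simp add: indicator_def)
      then show "(\<lambda>k. bump k 0 1 x) \<longlonglongrightarrow> indicator {0<..<1::real} x *\<^sub>R (1::complex)"
        using bump_tendsto[of 0 1 x] by simp
    qed
    show "AE x in lborel. norm (bump k 0 1 x) \<le> indicator {0..1::real} x" for k
    proof (rule AE_I2)
      fix x show "norm (bump k 0 1 x) \<le> indicator {0..1::real} x"
        using bump_norm_le[of k 0 1 x] by (cases "0 < x \<and> x < 1") (auto simp: bump_eq[of k 0 1 x])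
    qed
  qed auto
  moreover have "(LINT x|lborel. indicator {0<..<1::real} x *\<^sub>R (1::complex)) = 1"
    by (subst Bochner_Integration.integral_scaleR_left) auto
  ultimately have "(\<lambda>k. LINT x|lborel. bump k 0 1 x) \<longlonglongrightarrow> 1" by simp
  then have "eventually (\<lambda>k. (LINT x|lborel. bump k 0 1 x) \<noteq> 0) sequentially"
    by (rule tendsto_imp_eventually_ne) simp
  then show ?thesis by (auto simp: eventually_sequentially)
qed

text \<open>By dominated convergence the integral of \<open>w\<close> over every bounded open interval vanishes. Hence so does its integral
over every Borel subset of a bounded interval, by Dynkin's lemma with the half-lines \<open>{..a}\<close> as generator.\<close>

lemma AE_zero_if_integral_bump_zero:
  fixes w :: "real \<Rightarrow> complex"
  assumes w: "\<And>a b. set_integrable lborel {a..b} w"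
    and zero: "\<And>k a b. (LINT x|lborel. w x * bump k a b x) = 0"
  shows "AE x in lborel. w x = 0"
proof -
  have interval: "(LINT x:{a<..<b}|lborel. w x) = 0" for a b
  proof -
    have int: "integrable lborel (\<lambda>x. indicat_real {a..b} x *\<^sub>R w x)"
      using w[of a b] by (simp add: set_integrable_def)
    have "(\<lambda>k. LINT x|lborel. w x * bump k a b x) \<longlonglongrightarrow> (LINT x|lborel. indicat_real {a<..<b} x *\<^sub>R w x)"
    proof (rule integral_dominated_convergence)
      show "integrable lborel (\<lambda>x. norm (indicat_real {a..b} x *\<^sub>R w x))"
        using int by (rule integrable_norm)
      have "(\<lambda>x. indicat_real {a<..<b} x *\<^sub>R (indicat_real {a..b} x *\<^sub>R w x)) \<in> borel_measurable lborel"
        using int by measurable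
      then show "(\<lambda>x. indicat_real {a<..<b} x *\<^sub>R w x) \<in> borel_measurable lborel"
        by (rule measurable_cong[THEN iffD1, rotated]) (auto simp: indicator_def)
      show "(\<lambda>x. w x * bump k a b x) \<in> borel_measurable lborel" for k
      proof -
        have "(\<lambda>x. (indicat_real {a..b} x *\<^sub>R w x) * bump k a b x) \<in> borel_measurable lborel"
          using int by measurable
        then show ?thesis
          by (rule measurable_cong[THEN iffD1, rotated]) (auto simp: indicator_def bump_eq)
      qed
      show "AE x in lborel. (\<lambda>k. w x * bump k a b x) \<longlonglongrightarrow> indicat_real {a<..<b} x *\<^sub>R w x"
      proof (rule AE_I2)
        fix x
        have "(\<lambda>k. w x * bump k a b x) \<longlonglongrightarrow> w x * indicator {a<..<b} x"
          by (intro tendsto_intros bump_tendsto)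
        moreover have "w x * indicator {a<..<b} x = indicat_real {a<..<b} x *\<^sub>R w x"
          by (simp add: indicator_def)
        ultimately show "(\<lambda>k. w x * bump k a b x) \<longlonglongrightarrow> indicat_real {a<..<b} x *\<^sub>R w x" by simp
      qed
      show "AE x in lborel. norm (w x * bump k a b x) \<le> norm (indicat_real {a..b} x *\<^sub>R w x)" for k
      proof (rule AE_I2)
        fix x
        have "norm (w x) * norm (bump k a b x) \<le> norm (w x) * 1"
          by (intro mult_left_mono bump_norm_le) simp
        then show "norm (w x * bump k a b x) \<le> norm (indicat_real {a..b} x *\<^sub>R w x)"
          by (cases "a < x \<and> x < b") (auto simp: norm_mult bump_eq)
      qed
    qed
    then show ?thesis using zero by (simp add: LIMSEQ_const_iff set_lebesgue_integral_def)
  qed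
  have "AE x in lborel. indicat_real {- real N<..<real N} x *\<^sub>R w x = 0" for N
  proof (rule sigma_finite_measure.density_zero[OF lborel.sigma_finite_measure_axioms])
    let ?w = "\<lambda>x. indicat_real {- real N<..<real N} x *\<^sub>R w x"
    have "set_integrable lborel {- real N<..<real N} w"
      using w[of "- real N" "real N"] by (rule set_integrable_subset) auto
    then show int: "integrable lborel ?w" by (simp add: set_integrable_def)
    fix A :: "real set" assume "A \<in> sets lborel"
    then have mem: "A \<in> sigma_sets UNIV (range atMost)"
      by (simp add: borel_eq_atMost)
    have stable: "Int_stable (range (atMost :: real \<Rightarrow> real set))"
      by (auto simp: Int_stable_def)
    have sub: "range (atMost :: real \<Rightarrow> real set) \<subseteq> Pow UNIV" by simp
    from stable sub mem show "(LINT x:A|lborel. ?w x) = 0"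
    proof (induction rule: sigma_sets_induct_disjoint)
      case (basic A)
      then obtain a where A: "A = {..a}" by auto
      have "(LINT x:A|lborel. ?w x) = (LINT x:{-real N<..<real N} \<inter> {..a}|lborel. w x)"
        unfolding set_lebesgue_integral_def by (intro Bochner_Integration.integral_cong) (auto simp: A indicator_def)
      also have "\<dots> = (LINT x:{-real N<..<min a (real N)}|lborel. w x)"
        by (rule set_integral_discrete_difference[where X="{a}"]) auto
      finally show ?case using interval by simp
    next
      case (compl A)
      then have A: "A \<in> sets lborel" by (simp add: borel_eq_atMost)
      have "(LINT x:UNIV|lborel. ?w x) = (LINT x:{-real N<..<real N}|lborel. w x)"
        by (simp add: set_lebesgue_integral_def)
      also have "\<dots> = 0" by (rule interval)
      finally have "(LINT x:UNIV|lborel. ?w x) = 0" .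
      moreover have "(LINT x:A \<union> (UNIV - A)|lborel. ?w x) = (LINT x:A|lborel. ?w x) + (LINT x:(UNIV - A)|lborel. ?w x)"
        using A int by (intro set_integral_Un) (auto simp: set_integrable_def intro!: integrable_mult_indicator simp del: scaleR_scaleR)
      ultimately show ?case using compl by (simp add: Un_Diff_cancel)
    next
      case (union A)
      have "range A \<subseteq> sets lborel" using union.hyps by (simp add: borel_eq_atMost)
      then have "(LINT x:(\<Union>i. A i)|lborel. ?w x) = (\<Sum>i. LINT x:A i|lborel. ?w x)"
        using union.hyps int
        by (intro lebesgue_integral_countable_add) (auto simp: disjoint_family_on_def set_integrable_def intro!: integrable_mult_indicator simp del: scaleR_scaleR)
      then show ?case using union.IH by simp
    qed (auto simp: set_lebesgue_integral_def)
  qed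
  then have "AE x in lborel. \<forall>N. indicat_real {- real N<..<real N} x *\<^sub>R w x = 0"
    by (intro AE_all_countable[THEN iffD2] allI)
  then show ?thesis
  proof eventually_elim
    fix x assume *: "\<forall>N. indicat_real {- real N<..<real N} x *\<^sub>R w x = 0"
    obtain N where "\<bar>x\<bar> < real N" using reals_Archimedean2 by blast
    then show "w x = 0" using *[rule_format, of N] by (auto simp: indicator_def abs_less_iff)
  qed
qed

section \<open>Primitives and weak derivatives\<close>

lemma integrable_mult_compact_support:
  fixes w \<phi> :: "real \<Rightarrow> complex"
  assumes w: "\<And>a b. set_integrable lborel {a..b} w" and \<phi>: "continuous_on UNIV \<phi>"
    and supp: "\<And>x. R < \<bar>x\<bar> \<Longrightarrow> \<phi> x = 0"
  shows "integrable lborel (\<lambda>x. w x * \<phi> x)"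
proof -
  have "bounded (\<phi> ` {-R..R})"
    by (intro compact_imp_bounded compact_continuous_image continuous_on_subset[OF \<phi>]) auto
  then obtain C where C: "\<And>x. x \<in> {-R..R} \<Longrightarrow> norm (\<phi> x) \<le> C"
    by (meson bounded_iff imageI)
  have [measurable]: "\<phi> \<in> borel_measurable borel" using \<phi> by (rule borel_measurable_continuous_onI)
  have int: "integrable lborel (\<lambda>x. indicat_real {-R..R} x *\<^sub>R w x)"
    using w[of "-R" R] by (simp add: set_integrable_def)
  have eq: "(\<lambda>x. w x * \<phi> x) = (\<lambda>x. (indicat_real {-R..R} x *\<^sub>R w x) * \<phi> x)"
    using supp by (auto simp: fun_eq_iff indicator_def abs_le_iff not_le)
  have "integrable lborel (\<lambda>x. C * norm (indicat_real {-R..R} x *\<^sub>R w x))"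
    using int by (intro integrable_mult_right integrable_norm)
  then show ?thesis unfolding eq
  proof (rule Bochner_Integration.integrable_bound)
    show "(\<lambda>x. (indicat_real {-R..R} x *\<^sub>R w x) * \<phi> x) \<in> borel_measurable lborel"
      using int by measurable
    show "AE x in lborel. norm ((indicat_real {-R..R} x *\<^sub>R w x) * \<phi> x) \<le> norm (C * norm (indicat_real {-R..R} x *\<^sub>R w x))"
    proof (rule AE_I2)
      fix x
      show "norm ((indicat_real {-R..R} x *\<^sub>R w x) * \<phi> x) \<le> norm (C * norm (indicat_real {-R..R} x *\<^sub>R w x))"
      proof (cases "x \<in> {-R..R}")
        case True
        have "norm (\<phi> x) * norm (w x) \<le> \<bar>C\<bar> * norm (w x)"
          using C[OF True] by (intro mult_right_mono) auto
        then show ?thesis using True by (simp add: norm_mult mult.commute abs_mult)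
      qed simp
    qed
  qed
qed

text \<open>Fubini's theorem for the integrand \<open>H s * \<psi>' x\<close> on the triangle \<open>s \<le> x\<close>: integrating over \<open>s\<close> produces the
increment of \<open>F\<close>, integrating over \<open>x\<close> produces \<open>- \<psi> s\<close>.\<close>

lemma integral_by_parts_primitive:
  assumes prim: "primitive_of F H"
    and d: "\<And>x. (\<psi> has_vector_derivative \<psi>' x) (at x)" and cont: "continuous_on UNIV \<psi>'"
    and supp: "\<And>x. R < \<bar>x\<bar> \<Longrightarrow> \<psi> x = 0"
  shows "(LINT x|lborel. F x * \<psi>' x) = - (LINT x|lborel. H x * \<psi> x)"
proof -
  have supp': "\<psi>' x = 0" if "R < \<bar>x\<bar>" for x
    using derivative_zero_outside[OF d supp that] .
  define a b where "a = - \<bar>R\<bar> - 1" and "b = \<bar>R\<bar> + 1"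
  have ab: "a \<le> b" by (simp add: a_def b_def)
  have zero: "\<psi> a = 0" "\<psi> b = 0" using supp by (auto simp: a_def b_def)
  have outside: "\<psi> x = 0 \<and> \<psi>' x = 0" if "x \<notin> {a..b}" for x
    using that supp[of x] supp'[of x] by (auto simp: a_def b_def abs_if split: if_splits)
  define h where "h s = indicat_real {a..b} s *\<^sub>R H s" for s
  define k where "k x = indicat_real {a..b} x *\<^sub>R \<psi>' x" for x
  have FTC: "has_bochner_integral lborel (\<lambda>x. indicat_real {s..b} x *\<^sub>R \<psi>' x) (\<psi> b - \<psi> s)" if "s \<le> b" for s
    using that continuous_on_subset[OF cont]
    by (intro has_bochner_integral_FTC_Icc) (auto intro: has_vector_derivative_at_within d)
  have h: "integrable lborel h"
    using prim by (simp add: h_def[abs_def] primitive_of_def set_integrable_def)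
  have k: "integrable lborel k"
    using FTC[OF ab] by (auto simp: k_def[abs_def] has_bochner_integral_iff)
  have k0: "(LINT x|lborel. k x) = 0"
    using FTC[OF ab] zero by (auto simp: k_def[abs_def] has_bochner_integral_iff)
  have [measurable]: "h \<in> borel_measurable borel" "k \<in> borel_measurable borel"
    using h k by auto
  define f where "f s x = (if s \<le> x then h s * k x else 0)" for s x
  have "integrable (lborel \<Otimes>\<^sub>M lborel) (\<lambda>(s, x). h s * k x)"
  proof (rule lborel_pair.Fubini_integrable)
    show "integrable lborel (\<lambda>s. LINT x|lborel. norm (case (s, x) of (s, x) \<Rightarrow> h s * k x))"
      using h by (simp add: norm_mult)
    show "AE s in lborel. integrable lborel (\<lambda>x. case (s, x) of (s, x) \<Rightarrow> h s * k x)"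
      using k by simp
  qed measurable
  then have intf: "integrable (lborel \<Otimes>\<^sub>M lborel) (\<lambda>(s, x). f s x)"
    by (rule Bochner_Integration.integrable_bound) (auto simp: f_def[abs_def])
  have inner_s: "(LINT s|lborel. f s x) = (F x - F a) * k x" for x
  proof (cases "x \<in> {a..b}")
    case False
    then have "k x = 0" by (simp add: k_def)
    then have "f s x = 0" for s by (simp add: f_def)
    then show ?thesis using \<open>k x = 0\<close> by simp
  next
    case True
    have "(LINT s|lborel. f s x) = (LINT s|lborel. (indicat_real {a..x} s *\<^sub>R H s) * k x)"
      using True by (intro Bochner_Integration.integral_cong) (auto simp: f_def h_def indicator_def)
    also have "\<dots> = (LINT s:{a..x}|lborel. H s) * k x"
      unfolding set_lebesgue_integral_def by (rule integral_mult_left_zero)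
    finally show ?thesis using prim True by (simp add: primitive_of_def)
  qed
  have inner_x: "(LINT x|lborel. f s x) = - (H s * \<psi> s)" for s
  proof (cases "s \<in> {a..b}")
    case False
    then have "f s x = 0" for x by (simp add: f_def h_def)
    then show ?thesis using outside[OF False] by simp
  next
    case True
    have "(LINT x|lborel. f s x) = (LINT x|lborel. h s * (indicat_real {s..b} x *\<^sub>R \<psi>' x))"
      using True by (intro Bochner_Integration.integral_cong) (auto simp: f_def k_def indicator_def)
    also have "\<dots> = h s * (LINT x|lborel. indicat_real {s..b} x *\<^sub>R \<psi>' x)"
      by (rule integral_mult_right_zero)
    also have "(LINT x|lborel. indicat_real {s..b} x *\<^sub>R \<psi>' x) = - \<psi> s"
      using FTC[of s] True zero by (auto simp: has_bochner_integral_iff)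
    finally show ?thesis using True by (simp add: h_def)
  qed
  have Fk: "integrable lborel (\<lambda>x. F x * k x)"
  proof -
    have "integrable lborel (\<lambda>x. (LINT s|lborel. f s x) + F a * k x)"
      using lborel_pair.integrable_snd[OF intf] k by (intro Bochner_Integration.integrable_add) auto
    then show ?thesis by (simp add: inner_s algebra_simps)
  qed
  have "(LINT x|lborel. F x * \<psi>' x) = (LINT x|lborel. (F x - F a) * k x + F a * k x)"
    by (intro Bochner_Integration.integral_cong) (use outside in \<open>auto simp: k_def algebra_simps indicator_def\<close>)
  also have "\<dots> = (LINT x|lborel. (F x - F a) * k x) + F a * (LINT x|lborel. k x)"
    using Fk k by (subst Bochner_Integration.integral_add) (auto simp: algebra_simps)
  also have "\<dots> = (LINT x|lborel. LINT s|lborel. f s x)" by (simp add: inner_s k0)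
  also have "\<dots> = (LINT s|lborel. LINT x|lborel. f s x)"
    by (rule lborel_pair.Fubini_integral[OF intf])
  finally show ?thesis by (simp add: inner_x)
qed

lemma primitive_of_exists:
  assumes H: "\<And>a b. set_integrable lborel {a..b} H"
  shows "\<exists>F. primitive_of F H"
proof -
  define F where "F x = (LBINT s=ereal 0..ereal x. H s)" for x :: real
  have "F b - F a = (LINT s:{a..b}|lborel. H s)" if "a \<le> b" for a b
  proof -
    have "(LBINT s=ereal 0..ereal a. H s) + (LBINT s=ereal a..ereal b. H s) = (LBINT s=ereal 0..ereal b. H s)"
    proof (rule interval_integral_sum)
      define x y where "x = min 0 (min a b)" and "y = max 0 (max a b)"
      have "x \<le> y" by (simp add: x_def y_def min_le_iff_disj)
      moreover have "set_integrable lborel {x<..<y} H"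
        by (rule set_integrable_subset[OF H[of x y]]) auto
      ultimately have "interval_lebesgue_integrable lborel (ereal x) (ereal y) H"
        by (simp add: interval_lebesgue_integrable_def)
      then show "interval_lebesgue_integrable lborel (min (ereal 0) (min (ereal a) (ereal b)))
          (max (ereal 0) (max (ereal a) (ereal b))) H"
        by (simp only: ereal_min ereal_max x_def y_def)
    qed
    then show ?thesis using that by (simp add: F_def interval_integral_Icc algebra_simps)
  qed
  then show ?thesis using H unfolding primitive_of_def by blast
qed

lemma flat_algebra_continuous: "f \<in> flat_algebra \<Longrightarrow> continuous_on S f"
  using flat_algebra_deriv[of f] 
  by (meson continuous_at_imp_continuous_on has_vector_derivative_continuous)

lemma const_set_integrable: "set_integrable lborel {a..b::real} (\<lambda>x. c :: complex)"
  unfolding set_integrable_def by (rule integrable_scaleR_left) (simp add: integrable_indicator_iff emeasure_lborel_Icc_eq)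

text \<open>The integral from the left end of the support is again compactly supported because the total integral vanishes.\<close>

lemma test_antiderivative:
  assumes z: "\<zeta> \<in> flat_algebra" and supp: "\<And>x. R < \<bar>x\<bar> \<Longrightarrow> \<zeta> x = 0"
    and int: "(LINT x|lborel. \<zeta> x) = 0"
  shows "\<exists>\<psi>\<in>test_functions. \<forall>x. (\<psi> has_vector_derivative \<zeta> x) (at x)"
proof -
  have cont: "continuous_on S \<zeta>" for S using z by (rule flat_algebra_continuous)
  define a b where "a = - \<bar>R\<bar> - 1" and "b = \<bar>R\<bar> + 1"
  have outside: "\<zeta> x = 0" if "x \<notin> {a<..<b}" for x
    using that supp[of x] by (auto simp: a_def b_def abs_if split: if_splits)
  define \<psi> where "\<psi> x = integral {a..x} \<zeta>" for x
  have left: "\<psi> x = 0" if "x < - \<bar>R\<bar>" for x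
    unfolding \<psi>_def by (rule integral_unique[OF has_integral_is_0]) (use supp that in auto)
  have total: "(\<zeta> has_integral 0) UNIV"
  proof -
    have "integrable lborel (\<lambda>x. 1 * \<zeta> x)"
      by (rule integrable_mult_compact_support[OF const_set_integrable cont supp])
    then show ?thesis using has_integral_integral_lborel[of \<zeta>] int by simp
  qed
  have right: "\<psi> x = 0" if "b \<le> x" for x
  proof -
    have "(\<zeta> has_integral 0) {a..x} \<longleftrightarrow> (\<zeta> has_integral 0) UNIV"
      by (rule has_integral_spike_set_eq) (use outside that in \<open>auto intro!: negligible_subset[OF negligible_empty]\<close>)
    then show ?thesis using total by (simp add: \<psi>_def integral_unique)
  qed
  have d: "(\<psi> has_vector_derivative \<zeta> x) (at x)" for x
  proof (cases "a < x")
    case True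
    have "(\<psi> has_vector_derivative \<zeta> x) (at x within {a..x+1})"
      unfolding \<psi>_def by (rule integral_has_vector_derivative) (use True cont in auto)
    then show ?thesis using True at_within_interior[of x "{a..x+1}"] by simp
  next
    case False
    have "((\<lambda>y. 0) has_vector_derivative \<zeta> x) (at x)"
      using outside[of x] False by simp
    moreover have "open {..<-\<bar>R\<bar>}" by simp
    ultimately show ?thesis
      by (rule has_vector_derivative_transform_within_open) (use False in \<open>auto simp: a_def left\<close>)
  qed
  have "smooth_on UNIV \<zeta>" using z by (rule flat_algebra_smooth)
  then obtain D where D: "has_derivs \<zeta> D" by (auto simp: smooth_on_real_iff)
  have "has_derivs \<psi> (\<lambda>n. case n of 0 \<Rightarrow> \<psi> | Suc m \<Rightarrow> D m)"
    using D d by (auto simp: has_derivs_def split: nat.split)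
  then have "smooth_on UNIV \<psi>" by (auto simp: smooth_on_real_iff)
  moreover have "\<forall>r. \<bar>r\<bar> > \<bar>R\<bar> + 1 \<longrightarrow> \<psi> r = 0"
    using left right by (auto simp: a_def b_def abs_if split: if_splits)
  ultimately have "\<psi> \<in> test_functions" by (auto simp: test_functions_def)
  then show ?thesis using d by blast
qed

lemma bump_support: "max \<bar>a\<bar> \<bar>b\<bar> < \<bar>x\<bar> \<Longrightarrow> bump k a b x = 0"
  by (auto simp: bump_eq)

lemma bump_in_test_functions: "bump k a b \<in> test_functions"
  using flat_algebra_smooth[OF bump_in_flat_algebra] bump_support unfolding test_functions_def by blast

lemma integrable_mult_bump:
  assumes "\<And>a b. set_integrable lborel {a..b} w"
  shows "integrable lborel (\<lambda>x. w x * bump k a b x)"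
  by (rule integrable_mult_compact_support[OF assms _ bump_support])
     (intro flat_algebra_continuous bump_in_flat_algebra)

text \<open>The lemma of du Bois-Reymond. If \<open>F\<close> is some primitive of \<open>H\<close>, then \<open>w = G - F\<close> has weak derivative zero, that is, it
integrates to zero against every test function with vanishing integral. Any bump becomes one of these after subtracting
a multiple of the fixed bump \<open>\<eta>\<close>, and this says that \<open>w\<close> acts on all bumps like the constant \<open>c\<close>.\<close>

lemma weak_derivative_imp_primitive:
  assumes G: "\<And>a b. set_integrable lborel {a..b} G" and H: "\<And>a b. set_integrable lborel {a..b} H"
    and weak: "\<And>\<psi> \<psi>'. \<psi> \<in> test_functions \<Longrightarrow> (\<And>x. (\<psi> has_vector_derivative \<psi>' x) (at x)) \<Longrightarrow>
      (LINT x|lborel. G x * \<psi>' x) = - (LINT x|lborel. H x * \<psi> x)"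
  shows "\<exists>F. primitive_of F H \<and> (AE x in lborel. G x = F x)"
proof -
  obtain F where F: "primitive_of F H" using primitive_of_exists[OF H] by blast
  have Floc: "set_integrable lborel {a..b} F" for a b
    using borel_integrable_compact[of "{a..b}" F] primitive_of_continuous[OF F]
    by (auto simp: set_integrable_def indicator_def[abs_def] if_distrib cong: if_cong)
  define w where "w x = G x - F x" for x
  have w: "set_integrable lborel {a..b} w" for a b
    unfolding w_def using G Floc by (rule set_integral_diff(1))
  obtain k0 where k0: "(LINT x|lborel. bump k0 0 1 x) \<noteq> 0" using integral_bump_nonzero by blast
  define \<eta> where "\<eta> = bump k0 0 1"
  define m where "m = (LINT x|lborel. \<eta> x)"
  define c where "c = (LINT x|lborel. w x * \<eta> x) / m"
  have bump_int: "integrable lborel (bump k a b)" for k a b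
    using integrable_mult_bump[OF const_set_integrable[where c=1]] by simp
  have "(LINT x|lborel. (w x - c) * bump k a b x) = 0" for k a b
  proof -
    define t where "t = (LINT x|lborel. bump k a b x) / m"
    \<comment> \<open>The multiple \<open>t\<close> is chosen to give \<open>\<zeta>\<close> vanishing integral.\<close>
    define \<zeta> where "\<zeta> x = bump k a b x + (- t) * \<eta> x" for x
    have z: "\<zeta> \<in> flat_algebra" unfolding \<zeta>_def[abs_def] \<eta>_def
      by (rule flat_algebra.add[OF bump_in_flat_algebra flat_algebra.scale[OF bump_in_flat_algebra]])
    have supp: "\<zeta> x = 0" if "max (max \<bar>a\<bar> \<bar>b\<bar>) 1 < \<bar>x\<bar>" for x
      using that bump_support[of a b x k] bump_support[of 0 1 x k0] by (simp add: \<zeta>_def \<eta>_def)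
    have "(LINT x|lborel. \<zeta> x) = (LINT x|lborel. bump k a b x) - t * m"
      unfolding \<zeta>_def using bump_int by (simp add: \<eta>_def m_def)
    then have "(LINT x|lborel. \<zeta> x) = 0" using k0 by (simp add: t_def m_def \<eta>_def)
    from test_antiderivative[OF z supp this] obtain \<psi> where \<psi>: "\<psi> \<in> test_functions"
      "\<And>x. (\<psi> has_vector_derivative \<zeta> x) (at x)" by blast
    obtain R where R: "\<And>x. R < \<bar>x\<bar> \<Longrightarrow> \<psi> x = 0" using \<psi>(1) by (auto simp: test_functions_def)
    have "(LINT x|lborel. G x * \<zeta> x) = (LINT x|lborel. F x * \<zeta> x)"
      using weak[OF \<psi>] integral_by_parts_primitive[OF F \<psi>(2) flat_algebra_continuous[OF z] R] by simp
    moreover have "integrable lborel (\<lambda>x. G x * \<zeta> x)"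
      by (rule integrable_mult_compact_support[OF G flat_algebra_continuous[OF z] supp])
    moreover have "integrable lborel (\<lambda>x. F x * \<zeta> x)"
      by (rule integrable_mult_compact_support[OF Floc flat_algebra_continuous[OF z] supp])
    ultimately have "(LINT x|lborel. w x * \<zeta> x) = 0"
      by (simp add: w_def left_diff_distrib)
    moreover have "(LINT x|lborel. w x * \<zeta> x) = (LINT x|lborel. w x * bump k a b x - t * (w x * \<eta> x))"
      by (intro Bochner_Integration.integral_cong) (auto simp: \<zeta>_def algebra_simps)
    moreover have "\<dots> = (LINT x|lborel. w x * bump k a b x) - t * (LINT x|lborel. w x * \<eta> x)"
      using integrable_mult_bump[OF w] by (simp add: \<eta>_def)
    moreover have "t * (LINT x|lborel. w x * \<eta> x) = c * (LINT x|lborel. bump k a b x)"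
      by (simp add: t_def c_def)
    ultimately have "(LINT x|lborel. w x * bump k a b x) = c * (LINT x|lborel. bump k a b x)" by simp
    then show ?thesis
      using integrable_mult_bump[OF w] bump_int by (simp add: left_diff_distrib)
  qed
  moreover have "set_integrable lborel {a..b} (\<lambda>x. w x - c)" for a b
    using w by (rule set_integral_diff(1)) (rule const_set_integrable)
  ultimately have "AE x in lborel. w x - c = 0" by (intro AE_zero_if_integral_bump_zero)
  then have "AE x in lborel. G x = F x + c"
    by eventually_elim (simp add: w_def algebra_simps)
  moreover have "primitive_of (\<lambda>x. F x + c) H" using F by (simp add: primitive_of_def)
  ultimately show ?thesis by blast
qed

section \<open>Functions of the first variable as Schwartz functions\<close>

lemma has_derivs_zero_outside:
  assumes "has_derivs f D" "\<And>x. R < \<bar>x\<bar> \<Longrightarrow> f x = 0" "R < \<bar>x\<bar>"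
  shows "D n x = 0"
  using assms(3)
proof (induction n arbitrary: x)
  case (Suc n)
  show ?case
    using derivative_zero_outside[of "D n" "D (Suc n)" R x] Suc assms(1) by (auto simp: has_derivs_def)
qed (use assms in \<open>auto simp: has_derivs_def\<close>)

text \<open>This is the bound on the Schwartz seminorms of a function of \<open>r\<close> alone.\<close>

lemma has_derivs_bounded:
  assumes D: "has_derivs f D" and supp: "\<And>x. R < \<bar>x\<bar> \<Longrightarrow> f x = 0"
  obtains C where "\<And>x. \<bar>x\<bar> ^ k * norm (D n x) \<le> C"
proof -
  have "isCont (D n) x" for x
    using D has_vector_derivative_continuous unfolding has_derivs_def by blast
  then have "continuous_on {-\<bar>R\<bar>..\<bar>R\<bar>} (\<lambda>x. \<bar>x\<bar> ^ k * norm (D n x))"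
    by (intro continuous_intros continuous_at_imp_continuous_on) auto
  then have "bounded ((\<lambda>x. \<bar>x\<bar> ^ k * norm (D n x)) ` {-\<bar>R\<bar>..\<bar>R\<bar>})"
    by (intro compact_imp_bounded compact_continuous_image) auto
  then obtain C where C: "\<And>x. x \<in> {-\<bar>R\<bar>..\<bar>R\<bar>} \<Longrightarrow> norm (\<bar>x\<bar> ^ k * norm (D n x)) \<le> C"
    by (meson bounded_iff imageI)
  have "\<bar>x\<bar> ^ k * norm (D n x) \<le> \<bar>C\<bar>" for x
  proof (cases "x \<in> {-\<bar>R\<bar>..\<bar>R\<bar>}")
    case True
    then show ?thesis using C[OF True] by simp
  next
    case False
    then have "R < \<bar>x\<bar>" by auto
    from has_derivs_zero_outside[OF D supp this] show ?thesis by simp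
  qed
  then show ?thesis by (rule that)
qed

text \<open>Off the axis \<open>snd z = 0\<close> the radial extension of a function of \<open>r\<close> is that function of \<open>r\<close> itself. A derivative in
direction \<open>v\<close> therefore contributes the factor \<open>fst v\<close> and one derivative in \<open>r\<close>; in particular
all derivatives along the sphere vanish.\<close>

lemma pderivs_radial_ext_const_ext:
  fixes vs :: "(real \<times> (real ^ 'n)) list"
  assumes D: "has_derivs \<psi> D" and z: "snd z \<noteq> 0"
  shows "pderivs vs (radial_ext (const_ext \<psi>)) z = of_real (\<Prod>v\<leftarrow>vs. fst v) * D (length vs) (fst z)"
    and "pderivs vs (radial_ext (const_ext \<psi>)) differentiable (at z)"
proof -
  let ?U = "{z :: real \<times> (real ^ 'n). snd z \<noteq> 0}"
  have U: "open ?U" by (intro open_Collect_neq continuous_intros)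
  have der: "((\<lambda>z. of_real c * D n (fst z)) has_derivative (\<lambda>h. of_real c * (fst h *\<^sub>R D (Suc n) (fst z)))) (at z)"
    for n c and z :: "real \<times> (real ^ 'n)"
  proof -
    have "(D n has_derivative (\<lambda>h. h *\<^sub>R D (Suc n) (fst z))) (at (fst z))"
      using D by (simp add: has_derivs_def has_vector_derivative_def)
    from has_derivative_compose[OF has_derivative_fst[OF has_derivative_ident] this]
    show ?thesis by (intro has_derivative_mult_right)
  qed
  have eq: "pderivs vs (radial_ext (const_ext \<psi>)) z = of_real (\<Prod>v\<leftarrow>vs. fst v) * D (length vs) (fst z)"
    and dz: "(pderivs vs (radial_ext (const_ext \<psi>)) has_derivative
      (\<lambda>h. of_real (\<Prod>v\<leftarrow>vs. fst v) * (fst h *\<^sub>R D (Suc (length vs)) (fst z)))) (at z)"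
    if "z \<in> ?U" for z using that
  proof (induction vs arbitrary: z)
    case Nil
    {
      case 1
      then show ?case using D by (simp add: radial_ext_def const_ext_def norm_sgn has_derivs_def)
    next
      case 2
      show ?case
        by (rule has_derivative_transform_within_open[OF der U 2])
           (use D in \<open>simp add: radial_ext_def const_ext_def norm_sgn has_derivs_def\<close>)
    }
  next
    case (Cons v vs)
    have step: "pderivs (v # vs) (radial_ext (const_ext \<psi>)) z
        = of_real (\<Prod>v\<leftarrow>v # vs. fst v) * D (length (v # vs)) (fst z)" if "z \<in> ?U" for z
      using frechet_derivative_at[OF Cons.IH(2)[OF that], symmetric]
      by (simp add: scaleR_conv_of_real)
    {
      case 1
      then show ?case by (rule step)
    next
      case 2
      show ?case
        by (rule has_derivative_transform_within_open[OF der U 2]) (simp only: step)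
    }
  qed
  show "pderivs vs (radial_ext (const_ext \<psi>)) z = of_real (\<Prod>v\<leftarrow>vs. fst v) * D (length vs) (fst z)"
    using eq z by simp
  show "pderivs vs (radial_ext (const_ext \<psi>)) differentiable (at z)"
    using dz[of z] z unfolding differentiable_def by blast
qed

lemma const_ext_in_schwartz:
  assumes \<psi>: "\<psi> \<in> test_functions"
  shows "(const_ext \<psi> :: real \<times> (real ^ 'n::finite) \<Rightarrow> complex) \<in> schwartz"
proof -
  obtain D where D: "has_derivs \<psi> D" using \<psi> by (auto simp: test_functions_def smooth_on_real_iff)
  obtain R where R: "\<And>x. R < \<bar>x\<bar> \<Longrightarrow> \<psi> x = 0" using \<psi> by (auto simp: test_functions_def)
  have "bdd_above (schwartz_weight k vs (const_ext \<psi>) ` (UNIV \<times> sphere 0 1))"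
    for k and vs :: "(real \<times> (real ^ 'n)) list"
  proof -
    obtain C where C: "\<And>x. \<bar>x\<bar> ^ k * norm (D (length vs) x) \<le> C"
      using has_derivs_bounded[OF D R, where k=k and n="length vs"] by blast
    define P where "P = norm (complex_of_real (\<Prod>v\<leftarrow>vs. fst v))"
    have "schwartz_weight k vs (const_ext \<psi>) z \<le> P * C" if "z \<in> UNIV \<times> sphere 0 1" for z
    proof -
      have z: "snd z \<noteq> 0" using that by auto
      have "schwartz_weight k vs (const_ext \<psi>) z = P * (\<bar>fst z\<bar> ^ k * norm (D (length vs) (fst z)))"
        unfolding schwartz_weight_def pderivs_radial_ext_const_ext(1)[OF D z] norm_mult P_def
        by (rule mult.left_commute)
      also have "\<dots> \<le> P * C" by (intro mult_left_mono C) (simp add: P_def)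
      finally show ?thesis .
    qed
    then show ?thesis by (intro bdd_aboveI2[where M="P * C"])
  qed
  moreover have "smooth_on (UNIV \<times> (- {0})) (radial_ext (const_ext \<psi> :: real \<times> (real ^ 'n) \<Rightarrow> complex))"
    unfolding smooth_on_def by (intro allI impI ballI pderivs_radial_ext_const_ext(2)[OF D]) auto
  ultimately show ?thesis by (auto simp: schwartz_def const_ext_def)
qed

lemma test_functions_derivative:
  assumes \<psi>: "\<psi> \<in> test_functions" and d: "\<And>x. (\<psi> has_vector_derivative \<psi>' x) (at x)"
  shows "\<psi>' \<in> test_functions"
proof -
  obtain D where D: "has_derivs \<psi> D" using \<psi> by (auto simp: test_functions_def smooth_on_real_iff)
  obtain R where R: "\<And>x. R < \<bar>x\<bar> \<Longrightarrow> \<psi> x = 0" using \<psi> by (auto simp: test_functions_def)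
  have "(\<psi> has_vector_derivative D 1 x) (at x)" for x
    using D unfolding has_derivs_def by (metis One_nat_def)
  then have "\<psi>' = D 1" using d vector_derivative_unique_at by blast
  then have "has_derivs \<psi>' (\<lambda>n. D (Suc n))" using D by (simp add: has_derivs_def)
  then show ?thesis
    using derivative_zero_outside[OF d R] by (auto simp: test_functions_def smooth_on_real_iff)
qed

lemma partial_r_const_ext:
  assumes "\<And>x. (\<psi> has_vector_derivative \<psi>' x) (at x)"
  shows "partial_r (const_ext \<psi>) = const_ext \<psi>'"
proof (rule ext)
  fix z :: "real \<times> (real ^ 'n)"
  obtain r x where z: "z = (r, x)" by (cases z)
  show "partial_r (const_ext \<psi>) z = const_ext \<psi>' z"
    using vector_derivative_at[OF assms[of r]]
    by (cases "norm x = 1") (auto simp: z partial_r_def const_ext_def)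
qed

section \<open>The mean over the sphere\<close>

lemma space_sphere_measure [simp]: "space (sphere_measure :: (real ^ 'n::finite) measure) = sphere 0 1"
  by (simp add: sphere_measure_def space_scale_measure space_restrict_space)

text \<open>The cone over the whole sphere is the punctured unit ball, and a point has Lebesgue measure zero.\<close>

lemma emeasure_sphere_measure:
  "emeasure (sphere_measure :: (real ^ 'n::finite) measure) (sphere 0 1) =
     of_nat CARD('n) * emeasure lborel (cball 0 1 :: (real ^ 'n) set)"
proof -
  have m: "(sgn :: real ^ 'n \<Rightarrow> _) \<in> restrict_space lborel (cball 0 1 - {0}) \<rightarrow>\<^sub>M restrict_space borel (sphere 0 1)"
  proof (rule measurable_restrict_space3)
    show "(sgn :: real ^ 'n \<Rightarrow> _) \<in> lborel \<rightarrow>\<^sub>M borel"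
      unfolding sgn_div_norm[abs_def] by measurable
  qed (auto simp: norm_sgn)
  have S: "sphere 0 1 \<in> sets (restrict_space borel (sphere 0 1 :: (real ^ 'n) set))"
    by (simp add: sets_restrict_space_iff)
  have pre: "(sgn :: real ^ 'n \<Rightarrow> _) -` sphere 0 1 \<inter> (cball 0 1 - {0}) = cball 0 1 - {0}"
    by (auto simp: norm_sgn)
  have "emeasure (sphere_measure :: (real ^ 'n) measure) (sphere 0 1) =
      of_nat CARD('n) * emeasure lborel (cball 0 1 - {0} :: (real ^ 'n) set)"
    unfolding sphere_measure_def
    by (simp add: emeasure_distr[OF m S] space_restrict_space pre emeasure_restrict_space)
  also have "emeasure lborel (cball 0 1 - {0} :: (real ^ 'n) set) = emeasure lborel (cball 0 1 :: (real ^ 'n) set)"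
    by (rule emeasure_Diff_null_set) auto
  finally show ?thesis .
qed

lemma finite_measure_sphere: "finite_measure (sphere_measure :: (real ^ 'n::finite) measure)"
proof
  show "emeasure (sphere_measure :: (real ^ 'n) measure) (space sphere_measure) \<noteq> \<infinity>"
    using emeasure_lborel_cball_finite[of "0 :: real ^ 'n" 1]
    by (simp add: emeasure_sphere_measure ennreal_mult_eq_top_iff less_top)
qed

lemma measure_sphere_pos: "0 < measure (sphere_measure :: (real ^ 'n::finite) measure) (sphere 0 1)"
proof -
  interpret S: finite_measure "sphere_measure :: (real ^ 'n) measure" by (rule finite_measure_sphere)
  have "measure lborel (cball 0 1 :: (real ^ 'n) set) > 0"
    by (simp add: content_cball_pos)
  then have "emeasure lborel (cball 0 1 :: (real ^ 'n) set) \<noteq> 0" by (auto simp: measure_def)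
  then have "emeasure (sphere_measure :: (real ^ 'n) measure) (sphere 0 1) \<noteq> 0"
    by (simp add: emeasure_sphere_measure)
  then have "measure (sphere_measure :: (real ^ 'n) measure) (sphere 0 1) \<noteq> 0"
    by (simp add: S.emeasure_eq_measure)
  then show ?thesis using measure_nonneg[of "sphere_measure :: (real ^ 'n) measure" "sphere 0 1"] by linarith
qed

definition sphere_mean :: "(real \<times> (real ^ 'n::finite) \<Rightarrow> complex) \<Rightarrow> real \<Rightarrow> complex" where
  "sphere_mean h r = (LINT x|sphere_measure. h (r, x)) / of_real (measure (sphere_measure :: (real ^ 'n) measure) (sphere 0 1))"

lemma pair_sigma_finite_cyl: "pair_sigma_finite lborel (sphere_measure :: (real ^ 'n::finite) measure)"
  by (intro pair_sigma_finite.intro lborel.sigma_finite_measure_axioms finite_measure.axioms(1) finite_measure_sphere)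

lemma le_one_plus_powr: "x \<le> 1 + x powr p" if "1 \<le> p" "0 \<le> x" for x p :: real
proof (cases "x \<le> 1")
  case False
  then have "x powr 1 \<le> x powr p" using that by (intro powr_mono) auto
  then show ?thesis using that by simp
qed (auto intro: order_trans[of _ 1])

text \<open>Jensen's inequality on almost every sphere, followed by Fubini's theorem. On the sphere, which has finite measure,
\<open>p\<close>-integrability implies integrability.\<close>

lemma sphere_mean_Lp:
  fixes h :: "real \<times> (real ^ 'n::finite) \<Rightarrow> complex"
  assumes p: "1 \<le> p" and h: "in_Lp p cyl_measure h"
  shows "sphere_mean h \<in> borel_measurable lborel"
    and "integrable lborel (\<lambda>r. norm (sphere_mean h r) powr p)"
    and "(LINT r|lborel. norm (sphere_mean h r) powr p) \<le>
      (LINT z|cyl_measure. norm (h z) powr p) / measure (sphere_measure :: (real ^ 'n) measure) (sphere 0 1)"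
proof -
  let ?S = "sphere_measure :: (real ^ 'n) measure"
  interpret S: finite_measure ?S by (rule finite_measure_sphere)
  interpret P: pair_sigma_finite lborel ?S by (rule pair_sigma_finite_cyl)
  define m where "m = measure ?S (sphere 0 1)"
  have m: "0 < m" unfolding m_def by (rule measure_sphere_pos)
  have hm[measurable]: "h \<in> borel_measurable (lborel \<Otimes>\<^sub>M ?S)"
    and hp: "integrable (lborel \<Otimes>\<^sub>M ?S) (\<lambda>z. norm (h z) powr p)"
    using h by (auto simp: in_Lp_def cyl_measure_def)
  show meas[measurable]: "sphere_mean h \<in> borel_measurable lborel"
    unfolding sphere_mean_def[abs_def] by measurable
  define J where "J r = (LINT x|?S. norm (h (r, x)) powr p)" for r
  have J: "integrable lborel J" unfolding J_def by (rule P.integrable_fst'[OF hp])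
  have "AE r in lborel. integrable ?S (\<lambda>x. norm (h (r, x)) powr p)"
    by (rule P.AE_integrable_fst'[OF hp])
  then have bound: "AE r in lborel. norm (sphere_mean h r) powr p \<le> J r / m"
  proof eventually_elim
    fix r assume int_p: "integrable ?S (\<lambda>x. norm (h (r, x)) powr p)"
    have "integrable ?S (\<lambda>x. 1 + norm (h (r, x)) powr p)" using int_p by simp
    then have int: "integrable ?S (\<lambda>x. norm (h (r, x)))"
      by (rule Bochner_Integration.integrable_bound) (use le_one_plus_powr[OF p] in auto)
    have "norm (sphere_mean h r) \<le> (LINT x|?S. norm (h (r, x))) / m"
      using m by (simp add: sphere_mean_def norm_divide divide_right_mono m_def)
    then have "norm (sphere_mean h r) powr p \<le> ((LINT x|?S. norm (h (r, x))) / m) powr p"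
      using p by (intro powr_mono2) auto
    also have "\<dots> = (LINT x|?S. norm (h (r, x))) powr p / m powr p"
      by (rule powr_divide)
    also have "\<dots> \<le> (m powr (p - 1) * J r) / m powr p"
      using S.integral_powr_le[OF p int int_p] m by (intro divide_right_mono) (auto simp: J_def m_def)
    also have "\<dots> = J r / m" using m by (simp add: powr_diff)
    finally show "norm (sphere_mean h r) powr p \<le> J r / m" .
  qed
  have Jm: "integrable lborel (\<lambda>r. J r / m)" using J by simp
  then show int: "integrable lborel (\<lambda>r. norm (sphere_mean h r) powr p)"
  proof (rule Bochner_Integration.integrable_bound)
    show "AE r in lborel. norm (norm (sphere_mean h r) powr p) \<le> norm (J r / m)"
      using bound by eventually_elim (auto intro: order_trans[OF _ abs_ge_self] simp del: abs_divide)
  qed measurable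
  have "(LINT r|lborel. norm (sphere_mean h r) powr p) \<le> (LINT r|lborel. J r / m)"
    by (rule integral_mono_AE[OF int Jm bound])
  also have "\<dots> = (LINT z|cyl_measure. norm (h z) powr p) / m"
    using P.integral_fst'[OF hp] by (simp add: J_def cyl_measure_def)
  finally show "(LINT r|lborel. norm (sphere_mean h r) powr p) \<le>
      (LINT z|cyl_measure. norm (h z) powr p) / measure ?S (sphere 0 1)"
    by (simp add: m_def)
qed

lemma set_integrable_of_powr:
  fixes H :: "real \<Rightarrow> complex"
  assumes p: "1 \<le> p" and H[measurable]: "H \<in> borel_measurable lborel"
    and Hp: "integrable lborel (\<lambda>r. norm (H r) powr p)"
  shows "set_integrable lborel {a..b} H"
proof -
  have "integrable lborel (\<lambda>r. indicat_real {a..b} r + norm (H r) powr p)"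
    using Hp by (intro Bochner_Integration.integrable_add) (auto simp: integrable_indicator_iff emeasure_lborel_Icc_eq)
  then show ?thesis unfolding set_integrable_def
    by (rule Bochner_Integration.integrable_bound)
       (use le_one_plus_powr[OF p] in \<open>auto simp: indicator_def\<close>)
qed

lemma integral_cyl_const_ext:
  fixes h :: "real \<times> (real ^ 'n::finite) \<Rightarrow> complex"
  assumes h: "\<And>R. set_integrable cyl_measure ({- R..R} \<times> sphere 0 1) h"
    and \<psi>: "\<psi> \<in> test_functions"
  shows "(LINT z|cyl_measure. h z * const_ext \<psi> z) =
    of_real (measure (sphere_measure :: (real ^ 'n) measure) (sphere 0 1)) * (LINT r|lborel. sphere_mean h r * \<psi> r)"
proof -
  let ?S = "sphere_measure :: (real ^ 'n) measure"
  interpret P: pair_sigma_finite lborel ?S by (rule pair_sigma_finite_cyl)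
  define m where "m = measure ?S (sphere 0 1)"
  have m: "m \<noteq> 0" unfolding m_def using measure_sphere_pos[where 'n='n] by simp
  obtain D where D: "has_derivs \<psi> D" using \<psi> by (auto simp: test_functions_def smooth_on_real_iff)
  obtain R where R: "\<And>x. R < \<bar>x\<bar> \<Longrightarrow> \<psi> x = 0" using \<psi> by (auto simp: test_functions_def)
  have "isCont \<psi> x" for x
    using D has_vector_derivative_continuous unfolding has_derivs_def by metis
  then have [measurable]: "\<psi> \<in> borel_measurable borel"
    by (intro borel_measurable_continuous_onI continuous_at_imp_continuous_on) auto
  obtain C where C: "\<And>x. norm (\<psi> x) \<le> C"
    using has_derivs_bounded[OF D R, where k=0 and n=0] D by (auto simp: has_derivs_def)
  define Q where "Q = {- R..R} \<times> (sphere 0 1 :: (real ^ 'n) set)"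
  have Q: "integrable (lborel \<Otimes>\<^sub>M ?S) (\<lambda>z. indicat_real Q z *\<^sub>R h z)"
    using h[of R] by (simp add: set_integrable_def Q_def cyl_measure_def)
  define f where "f z = (indicat_real Q z *\<^sub>R h z) * \<psi> (fst z)" for z
  have "integrable (lborel \<Otimes>\<^sub>M ?S) (\<lambda>z. C * norm (indicat_real Q z *\<^sub>R h z))"
    using Q by (intro integrable_mult_right integrable_norm)
  then have f: "integrable (lborel \<Otimes>\<^sub>M ?S) f"
  proof (rule Bochner_Integration.integrable_bound)
    have [measurable]: "(\<lambda>z. indicat_real Q z *\<^sub>R h z) \<in> borel_measurable (lborel \<Otimes>\<^sub>M ?S)" using Q by auto
    show "f \<in> borel_measurable (lborel \<Otimes>\<^sub>M ?S)"
      unfolding f_def[abs_def] by measurable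
    have "norm (f z) \<le> norm (C * norm (indicat_real Q z *\<^sub>R h z))" for z
    proof -
      have "norm (\<psi> (fst z)) * norm (indicat_real Q z *\<^sub>R h z) \<le> \<bar>C\<bar> * norm (indicat_real Q z *\<^sub>R h z)"
        by (rule mult_right_mono[OF order_trans[OF C abs_ge_self]]) simp
      then show ?thesis by (simp only: f_def norm_mult real_norm_def abs_mult abs_norm_cancel mult.commute)
    qed
    then show "AE z in lborel \<Otimes>\<^sub>M ?S. norm (f z) \<le> norm (C * norm (indicat_real Q z *\<^sub>R h z))" by simp
  qed
  have fc: "f (r, x) = h (r, x) * \<psi> r" if "x \<in> sphere 0 1" for r x
    using that R[of r] by (cases "R < \<bar>r\<bar>") (auto simp: f_def Q_def not_less abs_le_iff)
  have "(LINT z|cyl_measure. h z * const_ext \<psi> z) = (LINT z|(lborel \<Otimes>\<^sub>M ?S). f z)"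
    unfolding cyl_measure_def
    by (intro Bochner_Integration.integral_cong) (auto simp: space_pair_measure const_ext_def fc)
  also have "\<dots> = (LINT r|lborel. LINT x|?S. f (r, x))" by (rule P.integral_fst'[OF f, symmetric])
  also have "\<dots> = (LINT r|lborel. of_real m * (sphere_mean h r * \<psi> r))"
  proof (intro Bochner_Integration.integral_cong refl)
    fix r
    have "(LINT x|?S. f (r, x)) = (LINT x|?S. h (r, x) * \<psi> r)"
      by (intro Bochner_Integration.integral_cong) (auto simp: fc)
    also have "\<dots> = (LINT x|?S. h (r, x)) * \<psi> r" by (rule integral_mult_left_zero)
    finally show "(LINT x|?S. f (r, x)) = of_real m * (sphere_mean h r * \<psi> r)"
      using m by (simp add: sphere_mean_def m_def)
  qed
  finally show ?thesis by (simp add: m_def)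
qed

text \<open>Testing the equation for the radial derivative of \<open>g\<close> with functions of \<open>r\<close> alone shows that the mean of \<open>h\<close> is the weak
derivative of the mean of \<open>g\<close>.\<close>

lemma mean_function_primitive:
  fixes g :: "('n::finite) cyl_functional"
  assumes p: "1 \<le> p" and h: "dist_is_function (dist_partial_r g) h" and hp: "in_Lp p cyl_measure h"
    and G: "is_mean_function g G"
  shows "\<exists>F. primitive_of F (sphere_mean h) \<and> (AE r in lborel. G r = F r)"
proof (rule weak_derivative_imp_primitive)
  let ?S = "sphere_measure :: (real ^ 'n) measure"
  define m where "m = measure ?S (sphere 0 1)"
  have m: "m \<noteq> 0" unfolding m_def using measure_sphere_pos[where 'n='n] by simp
  have "set_integrable lborel {- max \<bar>a\<bar> \<bar>b\<bar> .. max \<bar>a\<bar> \<bar>b\<bar>} G" for a b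
    using G by (simp add: is_mean_function_def)
  then show "set_integrable lborel {a..b} G" for a b
    by (rule set_integrable_subset[of _ "{- max \<bar>a\<bar> \<bar>b\<bar> .. max \<bar>a\<bar> \<bar>b\<bar>}"]) auto
  show "set_integrable lborel {a..b} (sphere_mean h)" for a b
    by (rule set_integrable_of_powr[OF p sphere_mean_Lp(1,2)[OF p hp]])
  fix \<psi> \<psi>' assume \<psi>: "\<psi> \<in> test_functions" and d: "\<And>x. (\<psi> has_vector_derivative \<psi>' x) (at x)"
  obtain R where R: "\<And>x. R < \<bar>x\<bar> \<Longrightarrow> \<psi> x = 0" using \<psi> by (auto simp: test_functions_def)
  have "dist_partial_r g (const_ext \<psi>) = (LINT z|cyl_measure. h z * const_ext \<psi> z)"
    using h const_ext_in_schwartz[OF \<psi>, where 'n='n] R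
    unfolding dist_is_function_def by (force simp: const_ext_def)
  also have "\<dots> = of_real m * (LINT r|lborel. sphere_mean h r * \<psi> r)"
    using integral_cyl_const_ext[OF _ \<psi>, of h] h by (auto simp: dist_is_function_def m_def)
  finally have "- g (const_ext \<psi>') = of_real m * (LINT r|lborel. sphere_mean h r * \<psi> r)"
    by (simp add: dist_partial_r_def partial_r_const_ext[OF d])
  moreover have "g (const_ext \<psi>') = of_real m * (LINT r|lborel. G r * \<psi>' r)"
    using G test_functions_derivative[OF \<psi> d] m
    by (simp add: is_mean_function_def dist_mean_def m_def divide_eq_eq mult.commute)
  ultimately have "of_real m * (LINT r|lborel. G r * \<psi>' r)
      = of_real m * (- (LINT r|lborel. sphere_mean h r * \<psi> r))"
    by (metis add.inverse_inverse mult_minus_right)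
  then show "(LINT r|lborel. G r * \<psi>' r) = - (LINT r|lborel. sphere_mean h r * \<psi> r)"
    using m by (simp only: mult_cancel_left of_real_eq_0_iff) simp
qed

text \<open>The Besov norm refers to a representative picked by the choice operator; this makes it agree almost everywhere with any
given one.\<close>

lemma is_mean_function_unique:
  assumes G: "is_mean_function g G" and G': "is_mean_function g G'"
  shows "AE r in lborel. G r = G' r"
proof -
  have loc: "set_integrable lborel {a..b} F" if "is_mean_function g F" for a b F
    by (rule set_integrable_subset[of _ "{- max \<bar>a\<bar> \<bar>b\<bar> .. max \<bar>a\<bar> \<bar>b\<bar>}"])
       (use that in \<open>auto simp: is_mean_function_def\<close>)
  have "AE r in lborel. G r - G' r = 0"
  proof (rule AE_zero_if_integral_bump_zero)
    show "set_integrable lborel {a..b} (\<lambda>r. G r - G' r)" for a b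
      by (intro set_integral_diff(1) loc G G')
    show "(LINT r|lborel. (G r - G' r) * bump k a b r) = 0" for k a b
    proof -
      have "(LINT r|lborel. G r * bump k a b r) = (LINT r|lborel. G' r * bump k a b r)"
        using G G' bump_in_test_functions unfolding is_mean_function_def by metis
      then show ?thesis
        using integrable_mult_bump[OF loc[OF G]] integrable_mult_bump[OF loc[OF G']]
        by (simp add: left_diff_distrib)
    qed
  qed
  then show ?thesis by simp
qed

section \<open>From the heat bound to the inequality\<close>

text \<open>At time \<open>h\<^sup>2\<close> the Gaussian exponent is at least \<open>- 1/4\<close> for points at distance at most \<open>h\<close>, and
the normalising factor is \<open>1 / (2 * sqrt pi * h)\<close>.\<close>

lemma nn_integral_Icc_le_heat:
  assumes h: "0 < h" and r: "r \<in> {a..a+h}" and A: "A \<in> borel_measurable lborel"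
  shows "(\<integral>\<^sup>+s. A s * indicator {a..a+h} s \<partial>lborel) \<le> ennreal (2 * sqrt pi * exp (1/4) * h) * heat (h\<^sup>2) A r"
proof -
  define k where "k s = exp (- (r - s)\<^sup>2 / (4 * h\<^sup>2))" for s
  have "1 \<le> exp (1/4) * k s" if "s \<in> {a..a+h}" for s
  proof -
    have "(r - s)\<^sup>2 \<le> h\<^sup>2" using r that h by (intro abs_le_square_iff[THEN iffD1]) auto
    then have "(r - s)\<^sup>2 / (4 * h\<^sup>2) \<le> 1/4" using h by (simp add: field_simps)
    then show ?thesis by (simp add: k_def flip: exp_add)
  qed
  then have "A s * indicator {a..a+h} s \<le> ennreal (exp (1/4)) * (ennreal (k s) * A s)" for s
  proof (cases "s \<in> {a..a+h}")
    case True
    have "ennreal 1 * A s \<le> ennreal (exp (1/4) * k s) * A s"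
      using \<open>\<And>s. s \<in> {a..a+h} \<Longrightarrow> 1 \<le> exp (1/4) * k s\<close>[OF True] by (intro mult_right_mono ennreal_leI) auto
    then show ?thesis using True by (simp add: ennreal_mult' mult.assoc)
  qed simp
  then have "(\<integral>\<^sup>+s. A s * indicator {a..a+h} s \<partial>lborel)
      \<le> (\<integral>\<^sup>+s. ennreal (exp (1/4)) * (ennreal (k s) * A s) \<partial>lborel)"
    by (intro nn_integral_mono)
  also have "\<dots> = ennreal (exp (1/4)) * (\<integral>\<^sup>+s. ennreal (k s) * A s \<partial>lborel)"
    using A by (intro nn_integral_cmult) (auto simp: k_def[abs_def])
  also have "exp (1/4) = (2 * sqrt pi * exp (1/4) * h) * (1 / sqrt (4 * pi * h\<^sup>2))"
    using h by (simp add: real_sqrt_mult)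
  also have "ennreal \<dots> * (\<integral>\<^sup>+s. ennreal (k s) * A s \<partial>lborel) =
      ennreal (2 * sqrt pi * exp (1/4) * h) * heat (h\<^sup>2) A r"
    using h by (subst ennreal_mult) (auto simp: heat_def k_def mult.assoc)
  finally show ?thesis .
qed

text \<open>The norm at time \<open>h\<^sup>2\<close> bounds the average of \<open>norm (F s)\<close> over each interval of length \<open>h\<close>, and a function cannot exceed
its average everywhere. Taking \<open>b\<close> strictly larger than the norm gives a strict contradiction and also covers the
case that the norm is zero.\<close>

lemma low_point_of_B_norm:
  fixes g :: "('n::finite) cyl_functional"
  assumes \<beta>: "B_norm (- \<beta>) g < \<infinity>" and b: "enn2real (B_norm (- \<beta>) g) < b"
    and F: "F \<in> borel_measurable lborel" and ae: "AE r in lborel. mean_function g r = F r" and h: "0 < h"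
  shows "\<exists>s\<in>{a..a+h}. norm (F s) \<le> (2 * sqrt pi * exp (1/4) * b) * h powr (- \<beta>)"
proof (rule ccontr)
  assume "\<not> ?thesis"
  define K where "K = 2 * sqrt pi * exp (1/4)"
  have K: "0 < K" by (simp add: K_def)
  define B where "B = enn2real (B_norm (- \<beta>) g)"
  have B0: "0 \<le> B" by (simp add: B_def)
  have BB: "B_norm (- \<beta>) g = ennreal B" using \<beta> by (simp add: B_def)
  have b0: "0 < b" using b B0 unfolding B_def by linarith
  define A where "A s = ennreal (norm (F s))" for s
  have A: "A \<in> borel_measurable lborel" unfolding A_def[abs_def] using F by measurable
  have heat_eq: "heat (h\<^sup>2) (\<lambda>s. ennreal (norm (mean_function g s))) = heat (h\<^sup>2) A"
    unfolding heat_def A_def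
    by (intro ext arg_cong2[where f="(*)"] refl nn_integral_cong_AE) (use ae in eventually_elim, simp)
  have "ennreal ((h\<^sup>2) powr (- (- \<beta>) / 2)) * esssup lborel (heat (h\<^sup>2) (\<lambda>s. ennreal (norm (mean_function g s)))) \<le> B_norm (- \<beta>) g"
    unfolding B_norm_def by (rule SUP_upper) (use h in simp)
  moreover have "(h\<^sup>2) powr (- (- \<beta>) / 2) = h powr \<beta>"
    using h by (simp add: powr_powr flip: powr_numeral)
  ultimately have ess: "ennreal (h powr \<beta>) * esssup lborel (heat (h\<^sup>2) A) \<le> ennreal B"
    by (simp add: heat_eq BB)
  \<comment> \<open>The essential supremum bounds the heat evolution only almost everywhere; an interval of positive length contains a good point.\<close>
  have "\<exists>r\<in>{a..a+h}. heat (h\<^sup>2) A r \<le> esssup lborel (heat (h\<^sup>2) A)"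
  proof (rule ccontr)
    assume *: "\<not> ?thesis"
    have "AE r in lborel. r \<notin> {a..a+h}"
      using esssup_AE[of "heat (h\<^sup>2) A" lborel] by eventually_elim (use * in auto)
    then have "emeasure lborel {a..a+h} = 0"
      by (subst (asm) AE_iff_measurable[where N="{a..a+h}"]) auto
    then show False using h by simp
  qed
  then obtain r where r: "r \<in> {a..a+h}" "heat (h\<^sup>2) A r \<le> esssup lborel (heat (h\<^sup>2) A)" by blast
  have "ennreal (h powr \<beta>) * heat (h\<^sup>2) A r \<le> ennreal B"
    using order_trans[OF mult_left_mono[OF r(2)] ess] by simp
  have "ennreal (h powr \<beta>) * (\<integral>\<^sup>+s. A s * indicator {a..a+h} s \<partial>lborel)
      \<le> ennreal (h powr \<beta>) * (ennreal (K * h) * heat (h\<^sup>2) A r)"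
    using nn_integral_Icc_le_heat[OF h r(1) A] by (intro mult_left_mono) (auto simp: K_def)
  also have "\<dots> = ennreal (K * h) * (ennreal (h powr \<beta>) * heat (h\<^sup>2) A r)" by (rule mult.left_commute)
  also have "\<dots> \<le> ennreal (K * h) * ennreal B"
    by (intro mult_left_mono) (fact, simp)
  also have "\<dots> = ennreal (K * h * B)" using K h B0 by (simp add: ennreal_mult)
  finally have upper: "ennreal (h powr \<beta>) * (\<integral>\<^sup>+s. A s * indicator {a..a+h} s \<partial>lborel) \<le> ennreal (K * h * B)" .
  have "ennreal (K * b * h powr (- \<beta>)) * indicator {a..a+h} s \<le> A s * indicator {a..a+h} s" for s
    using \<open>\<not> (\<exists>s\<in>{a..a+h}. norm (F s) \<le> (2 * sqrt pi * exp (1/4) * b) * h powr (- \<beta>))\<close>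
    by (cases "s \<in> {a..a+h}") (auto simp: A_def K_def not_le intro!: ennreal_leI less_imp_le)
  then have "(\<integral>\<^sup>+s. ennreal (K * b * h powr (- \<beta>)) * indicator {a..a+h} s \<partial>lborel)
      \<le> (\<integral>\<^sup>+s. A s * indicator {a..a+h} s \<partial>lborel)"
    by (intro nn_integral_mono)
  then have "ennreal (h powr \<beta>) * (ennreal (K * b * h powr (- \<beta>)) * ennreal h)
      \<le> ennreal (h powr \<beta>) * (\<integral>\<^sup>+s. A s * indicator {a..a+h} s \<partial>lborel)"
    using h by (intro mult_left_mono) (auto simp: nn_integral_cmult_indicator)
  also note upper
  also have "ennreal (h powr \<beta>) * (ennreal (K * b * h powr (- \<beta>)) * ennreal h)
      = ennreal (h powr \<beta> * (K * b * h powr (- \<beta>) * h))"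
    using K h b0 by (simp add: ennreal_mult)
  also have "h powr \<beta> * (K * b * h powr (- \<beta>) * h) = K * h * b"
    using h by (simp add: powr_minus field_simps)
  finally have "K * h * b \<le> K * h * B" using K h B0 by (subst (asm) ennreal_le_iff) auto
  then show False using K h b by (simp add: B_def)
qed

lemma mean_Lq_bound:
  fixes g :: "('n::finite) cyl_functional"
  assumes p: "1 \<le> p" and pq: "p < q" and g: "g \<in> B_space (- (p / (q - p)))"
    and h: "dist_is_function (dist_partial_r g) h" and hp: "in_Lp p cyl_measure h"
    and G: "is_mean_function g G"
  shows "in_Lp q lborel G"
    and "(LINT r|lborel. norm (G r) powr q) \<le>
      4 powr q * (2 * sqrt pi * exp (1/4) * enn2real (B_norm (- (p / (q - p))) g)) powr (q - p) *
      ((LINT z|cyl_measure. norm (h z) powr p) / measure (sphere_measure :: (real ^ 'n) measure) (sphere 0 1))"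
proof -
  define \<beta> where "\<beta> = p / (q - p)"
  define K where "K = 2 * sqrt pi * exp (1/4)"
  have K: "0 < K" by (simp add: K_def)
  define b where "b = enn2real (B_norm (- \<beta>) g)"
  have b0: "0 \<le> b" by (simp add: b_def)
  define H where "H = sphere_mean h"
  define J where "J = (LINT r|lborel. norm (H r) powr p)"
  have J0: "0 \<le> J" by (simp add: J_def)
  have Hp: "integrable lborel (\<lambda>r. norm (H r) powr p)"
    unfolding H_def by (rule sphere_mean_Lp(2)[OF p hp])
  obtain F where F: "primitive_of F H" and GF: "AE r in lborel. G r = F r"
    using mean_function_primitive[OF p h hp G] unfolding H_def by blast
  have Fm[measurable]: "F \<in> borel_measurable borel"
    by (intro borel_measurable_continuous_onI primitive_of_continuous[OF F])
  \<comment> \<open>Local integrability speaks only of truncations; \<open>G\<close> is their pointwise limit.\<close>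
  have Gm[measurable]: "G \<in> borel_measurable borel"
  proof (rule borel_measurable_LIMSEQ_metric)
    show "(\<lambda>x. indicat_real {- real N..real N} x *\<^sub>R G x) \<in> borel_measurable borel" for N
    proof -
      have "integrable lborel (\<lambda>x. indicat_real {- real N..real N} x *\<^sub>R G x)"
        using G by (simp add: is_mean_function_def set_integrable_def)
      from borel_measurable_integrable[OF this] show ?thesis by simp
    qed
    show "(\<lambda>N. indicat_real {- real N..real N} x *\<^sub>R G x) \<longlonglongrightarrow> G x" for x
    proof (rule tendsto_eventually)
      obtain N where "\<bar>x\<bar> \<le> real N" using real_arch_simple by blast
      then show "eventually (\<lambda>N. indicat_real {- real N..real N} x *\<^sub>R G x = G x) sequentially"
        by (intro eventually_sequentiallyI[of N]) (auto simp: indicator_def abs_le_iff)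
    qed
  qed
  have "is_mean_function g (mean_function g)"
    unfolding mean_function_def by (rule someI[where P="is_mean_function g", OF G])
  from is_mean_function_unique[OF this G] GF have ae: "AE r in lborel. mean_function g r = F r"
    by eventually_elim simp
  have Bfin: "B_norm (- \<beta>) g < \<infinity>" using g by (simp add: B_space_def \<beta>_def)
  have bound: "(\<integral>\<^sup>+r. ennreal (norm (G r) powr q) \<partial>lborel) \<le> ennreal (4 powr q * (K * c) powr (q - p) * J)"
    if c: "b < c" for c
  proof -
    have Kc: "0 < K * c" using K c b0 by simp
    have "(\<integral>\<^sup>+r. ennreal (norm (G r) powr q) \<partial>lborel) = (\<integral>\<^sup>+r. ennreal (norm (F r) powr q) \<partial>lborel)"
      by (rule nn_integral_cong_AE) (use GF in eventually_elim, simp)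
    also have "\<dots> \<le> ennreal (4 powr q * (K * c) powr (q - p)) * (\<integral>\<^sup>+r. ennreal (norm (H r) powr p) \<partial>lborel)"
    proof (rule nn_integral_powr_le_of_low_points[OF p pq F Hp Kc])
      show "\<exists>s\<in>{a..a+l}. norm (F s) \<le> K * c * l powr (- (p / (q - p)))" if "0 < l" for a l
        using low_point_of_B_norm[OF Bfin c[unfolded b_def] _ ae that, of a] by (simp add: K_def \<beta>_def)
    qed
    also have "(\<integral>\<^sup>+r. ennreal (norm (H r) powr p) \<partial>lborel) = ennreal J"
      unfolding J_def by (rule nn_integral_eq_integral[OF Hp]) simp
    also have "ennreal (4 powr q * (K * c) powr (q - p)) * ennreal J = ennreal (4 powr q * (K * c) powr (q - p) * J)"
      using J0 by (simp add: ennreal_mult)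
    finally show ?thesis .
  qed
  have int: "integrable lborel (\<lambda>r. norm (G r) powr q)"
  proof (rule integrableI_bounded)
    have "(\<integral>\<^sup>+r. ennreal (norm (norm (G r) powr q)) \<partial>lborel) \<le> ennreal (4 powr q * (K * (b + 1)) powr (q - p) * J)"
      using bound[of "b + 1"] by simp
    then show "(\<integral>\<^sup>+r. ennreal (norm (norm (G r) powr q)) \<partial>lborel) < \<infinity>"
      by (rule le_less_trans) simp
  qed measurable
  then show "in_Lp q lborel G" by (simp add: in_Lp_def)
  define I where "I = (LINT r|lborel. norm (G r) powr q)"
  have "I \<le> 4 powr q * (K * c) powr (q - p) * J" if "b < c" for c
  proof -
    have "ennreal I \<le> ennreal (4 powr q * (K * c) powr (q - p) * J)"
      using bound[OF that] nn_integral_eq_integral[OF int] by (simp add: I_def)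
    then show ?thesis using J0 by (subst (asm) ennreal_le_iff) auto
  qed
  then have "eventually (\<lambda>c. I \<le> 4 powr q * (K * c) powr (q - p) * J) (at_right b)"
    by (auto simp: eventually_at_right_field intro: exI[of _ "b + 1"])
  \<comment> \<open>The low points are available for every constant above the norm; the estimate passes to the norm by continuity, also when the norm is zero.\<close>
  moreover have "((\<lambda>c. 4 powr q * (K * c) powr (q - p) * J) \<longlongrightarrow> 4 powr q * (K * b) powr (q - p) * J) (at_right b)"
  proof (intro tendsto_intros tendsto_powr')
    show "K * b \<noteq> 0 \<or> 0 < q - p \<and> (\<forall>\<^sub>F c in at_right b. 0 \<le> K * c)"
      using pq K b0 by (auto simp: eventually_at_right_field intro!: exI[of _ "b + 1"])
  qed
  ultimately have "I \<le> 4 powr q * (K * b) powr (q - p) * J"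
    by (intro tendsto_lowerbound[where F="at_right b"]) auto
  also have "\<dots> \<le> 4 powr q * (K * b) powr (q - p) *
      ((LINT z|cyl_measure. norm (h z) powr p) / measure (sphere_measure :: (real ^ 'n) measure) (sphere 0 1))"
    unfolding J_def H_def by (intro mult_left_mono sphere_mean_Lp(3)[OF p hp]) simp
  finally show "(LINT r|lborel. norm (G r) powr q) \<le>
      4 powr q * (2 * sqrt pi * exp (1/4) * enn2real (B_norm (- (p / (q - p))) g)) powr (q - p) *
      ((LINT z|cyl_measure. norm (h z) powr p) / measure (sphere_measure :: (real ^ 'n) measure) (sphere 0 1))"
    by (simp add: I_def K_def b_def \<beta>_def)
qed

theorem theorem3:
  fixes p q \<theta> :: real
  assumes "1 \<le> p" and "p < q" and "\<theta> = p / q"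
  shows "\<exists>C>0. \<forall>(g :: ('n::finite) cyl_functional) h G.
           g \<in> B_space (\<theta> / (\<theta> - 1)) \<and>
           dist_is_function (dist_partial_r g) h \<and> in_Lp p cyl_measure h \<and>
           is_mean_function g G \<longrightarrow>
           in_Lp q lborel G \<and>
           Lp_norm q lborel G \<le>
             C * Lp_norm p cyl_measure h powr \<theta>
               * enn2real (B_norm (\<theta> / (\<theta> - 1)) g) powr (1 - \<theta>)"
proof -
  define m where "m = measure (sphere_measure :: (real ^ 'n) measure) (sphere 0 1)"
  have m: "0 < m" unfolding m_def by (rule measure_sphere_pos)
  define K where "K = 2 * sqrt pi * exp (1/4)"
  have K: "0 < K" by (simp add: K_def)
  define A where "A = 4 powr q * K powr (q - p) / m"
  define C where "C = A powr (1 / q)"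
  have "0 < C" using K m by (simp add: C_def A_def)
  have q: "0 < q" using assms by simp
  have \<alpha>: "\<theta> / (\<theta> - 1) = - (p / (q - p))"
  proof -
    have "\<theta> - 1 = (p - q) / q" using assms(3) q by (simp add: field_simps)
    then have "\<theta> / (\<theta> - 1) = p / (p - q)" using assms(3) q by simp
    also have "\<dots> = - (p / (q - p))" by (metis minus_diff_eq minus_divide_right)
    finally show ?thesis .
  qed
  show ?thesis unfolding \<alpha>
  proof (intro exI[of _ C] conjI allI impI \<open>0 < C\<close>; elim conjE)
    fix g :: "'n cyl_functional" and h G
    assume g: "g \<in> B_space (- (p / (q - p)))" "dist_is_function (dist_partial_r g) h"
      "in_Lp p cyl_measure h" "is_mean_function g G"
    show "in_Lp q lborel G" by (rule mean_Lq_bound(1)[OF assms(1,2) g])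
    define b where "b = enn2real (B_norm (- (p / (q - p))) g)"
    define L where "L = (LINT z|cyl_measure. norm (h z) powr p)"
    have b: "0 \<le> b" and L: "0 \<le> L" by (auto simp: b_def L_def)
    have "Lp_norm q lborel G \<le> (4 powr q * (K * b) powr (q - p) * (L / m)) powr (1 / q)"
      unfolding Lp_norm_def using mean_Lq_bound(2)[OF assms(1,2) g] q
      by (intro powr_mono2) (auto simp: K_def b_def L_def m_def)
    also have "4 powr q * (K * b) powr (q - p) * (L / m) = A * L * b powr (q - p)"
      using K b by (simp add: A_def powr_mult)
    also have "\<dots> powr (1 / q) = C * L powr (1 / q) * (b powr (q - p)) powr (1 / q)"
      by (simp only: C_def powr_mult)
    also have "(b powr (q - p)) powr (1 / q) = b powr (1 - \<theta>)"
      using q assms by (simp add: powr_powr diff_divide_distrib)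
    also have "L powr (1 / q) = Lp_norm p cyl_measure h powr \<theta>"
      using assms by (simp add: Lp_norm_def powr_powr L_def)
    finally show "Lp_norm q lborel G \<le> C * Lp_norm p cyl_measure h powr \<theta>
        * enn2real (B_norm (- (p / (q - p))) g) powr (1 - \<theta>)" by (simp add: b_def)
  qed
qed

end
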